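(* Let $\mathcal{X},\mathcal{Y}$ be Polish spaces, $\mathcal{X}_n\in\mathcal{B}(\mathcal{X})$ and $\mathcal{Y}_n\in\mathcal{B}(\mathcal{Y})$, $n\in\mathbb{N}$, non-decreasing sequences with $\mathcal{X}_0\ne\emptyset$, $\mathcal{Y}_0\neq\emptyset$, let $Y_t$, $t\in\mathbb{Z}$, be a strictly stationary $\mathcal{Y}$-valued process, and let $Q$ be a parametrized family of transition kernels. Assume: $P(Y_0\notin\mathcal{Y}_n)\to0$ as $n\to\infty$, and there exist a non-increasing sequence $\alpha_n\in(0,1]$ and probabilities $\nu_n$ on $\mathcal{B}(\mathcal{X})$ such that $Q(x,y,A)\ge\alpha_n\nu_n(A)$ for all $n\in\mathbb{N}$, $x\in\mathcal{X}_n$, $y\in\mathcal{Y}_n$, $A\in\mathcal{B}(\mathcal{X})$. Assume also $\mathfrak{M}_b\ne\emptyset$. Let $X_t$, $t\in\mathbb{N}$, be a Markov chain in the random environment $Y$ with kernel $Q$, with $\mathcal{L}(X_0,(Y_k)_{k\in\mathbb{Z}})\in\mathfrak{M}_b$. Then: (i) there exists a probability $\mu_\sharp$ on $\mathcal{B}(\mathcal{X}\times\mathcal{Y}^{\mathbb{Z}})$ such that $\|\mathcal{L}(X_t,(Y_{t+k})_{k\in\mathbb{Z}})-\mu_\sharp\|_{TV}\to0$ as $t\to\infty$; (ii) if $X'_t$ is another Markov chain in the random environment $Y$ with kernel $Q$ and $\mathcal{L}(X'_0,(Y_k)_{k\in\mathbb{Z}})\in\mathfrak{M}_b$, then $\|\mathcal{L}(X_t,(Y_{t+k})_{k\in\mathbb{Z}})-\mathcal{L}(X'_t,(Y_{t+k})_{k\in\mathbb{Z}})\|_{TV}\to0$;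 in particular $\mu_\sharp$ does not depend on the choice of the initial condition in $\mathfrak{M}_b$; (iii) $\mu_\sharp$ is invariant: if $\mathcal{L}(X_0,(Y_k)_{k\in\mathbb{Z}})=\mu_\sharp$ then $\mathcal{L}(X_t,(Y_{t+k})_{k\in\mathbb{Z}})=\mu_\sharp$ for every $t\in\mathbb{N}$.
   Context: A parametrized family of transition kernels is a map $Q:\mathcal{X}\times\mathcal{Y}\times\mathcal{B}(\mathcal{X})\to[0,1]$ such that $Q(\cdot,\cdot,A)$ is measurable for each $A$ and $Q(x,y,\cdot)$ is a probability for each $(x,y)$. An $\mathcal{X}$-valued process $X_t$, $t\in\mathbb{N}$, is a Markov chain in the random environment $Y$ with kernel $Q$ if $P(X_{t+1}\in A\mid \sigma(Y_j, j\in\mathbb{Z}; X_j, 0\le j\le t))=Q(X_t,Y_t,A)$ for all $t\in\mathbb{N}$, $A\in\mathcal{B}(\mathcal{X})$. $\mathfrak{M}_0$ is the set of probability laws on $\mathcal{X}\times\mathcal{Y}^{\mathbb{Z}}$ whose second marginal equals the law of $(Y_k)_{k\in\mathbb{Z}}$; $\mathfrak{M}_b$ is the set of $\mu\in\mathfrak{M}_0$ such that the chain started with $\mathcal{L}(X_0,(Y_k)_{k\in\mathbb{Z}})=\mu$ satisfies $\sup_{t\in\mathbb{N}}P(X_t\notin\mathcal{X}_n)\to0$ as $n\to\infty$. $\|\mu\|_{TV}:=\sup_{|\phi|\le1}|\int\phi\,d\mu|$ over measurable $\phi$. *)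

theory Defs
  imports "HOL-Probability.Probability"
begin

abbreviation envM :: "('y::topological_space) itself \<Rightarrow> (int \<Rightarrow> 'y) measure" where
  "envM _ \<equiv> PiM UNIV (\<lambda>_::int. (borel :: 'y measure))"

abbreviation stateM :: "('x::topological_space) itself \<Rightarrow> ('y::topological_space) itself
    \<Rightarrow> ('x \<times> (int \<Rightarrow> 'y)) measure" where
  "stateM tx ty \<equiv> (borel :: 'x measure) \<Otimes>\<^sub>M envM ty"

definition param_kernel :: "('x::topological_space \<Rightarrow> 'y::topological_space \<Rightarrow> 'x measure) \<Rightarrow> bool" where
  "param_kernel Q \<longleftrightarrow>
     (\<forall>x y. prob_space (Q x y) \<and> sets (Q x y) = sets borel) \<and>
     (\<forall>A\<in>sets borel. (\<lambda>(x, y). measure (Q x y) A) \<in> borel_measurable (borel \<Otimes>\<^sub>M borel))"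

definition filt :: "'a measure \<Rightarrow> (nat \<Rightarrow> 'a \<Rightarrow> 'x::topological_space)
    \<Rightarrow> (int \<Rightarrow> 'a \<Rightarrow> 'y::topological_space) \<Rightarrow> nat \<Rightarrow> 'a measure" where
  "filt M X Y t = sigma (space M)
     ((\<Union>j. {Y j -` B \<inter> space M | B. B \<in> sets borel}) \<union>
      (\<Union>j\<in>{..t}. {X j -` B \<inter> space M | B. B \<in> sets borel}))"

definition mcre :: "'a measure \<Rightarrow> (nat \<Rightarrow> 'a \<Rightarrow> 'x::topological_space)
    \<Rightarrow> (int \<Rightarrow> 'a \<Rightarrow> 'y::topological_space) \<Rightarrow> ('x \<Rightarrow> 'y \<Rightarrow> 'x measure) \<Rightarrow> bool" where
  "mcre M X Y Q \<longleftrightarrow>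
     (\<forall>t. X t \<in> M \<rightarrow>\<^sub>M borel) \<and> (\<forall>j. Y j \<in> M \<rightarrow>\<^sub>M borel) \<and>
     (\<forall>t. \<forall>A\<in>sets borel.
        AE \<omega> in M. real_cond_exp M (filt M X Y t)
                      (indicator {\<omega>'\<in>space M. X (Suc t) \<omega>' \<in> A}) \<omega>
                    = measure (Q (X t \<omega>) (Y (int t) \<omega>)) A)"

definition law_at :: "'a measure \<Rightarrow> (nat \<Rightarrow> 'a \<Rightarrow> 'x::topological_space)
    \<Rightarrow> (int \<Rightarrow> 'a \<Rightarrow> 'y::topological_space) \<Rightarrow> nat \<Rightarrow> ('x \<times> (int \<Rightarrow> 'y)) measure" where
  "law_at M X Y t = distr M (stateM TYPE('x) TYPE('y)) (\<lambda>\<omega>. (X t \<omega>, \<lambda>k. Y (int t + k) \<omega>))"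

definition env_law :: "'a measure \<Rightarrow> (int \<Rightarrow> 'a \<Rightarrow> 'y::topological_space) \<Rightarrow> (int \<Rightarrow> 'y) measure" where
  "env_law M Y = distr M (envM TYPE('y)) (\<lambda>\<omega> k. Y k \<omega>)"

definition strictly_stationary :: "'a measure \<Rightarrow> (int \<Rightarrow> 'a \<Rightarrow> 'y::topological_space) \<Rightarrow> bool" where
  "strictly_stationary M Y \<longleftrightarrow>
     (\<forall>s::int. distr M (envM TYPE('y)) (\<lambda>\<omega> k. Y (k + s) \<omega>) = env_law M Y)"

definition tv_dist :: "'b measure \<Rightarrow> 'b measure \<Rightarrow> real" where
  "tv_dist \<mu> \<nu> = (SUP \<phi>\<in>{\<phi> \<in> borel_measurable \<mu>. \<forall>z. \<bar>\<phi> z\<bar> \<le> 1}.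
                    \<bar>(\<integral>z. \<phi> z \<partial>\<mu>) - (\<integral>z. \<phi> z \<partial>\<nu>)\<bar>)"

definition M0 :: "'a measure \<Rightarrow> (int \<Rightarrow> 'a \<Rightarrow> 'y::topological_space)
    \<Rightarrow> ('x::topological_space \<times> (int \<Rightarrow> 'y)) measure set" where
  "M0 M Y = {\<mu>. prob_space \<mu> \<and> sets \<mu> = sets (stateM TYPE('x) TYPE('y)) \<and>
                 distr \<mu> (envM TYPE('y)) snd = env_law M Y}"

definition tight_chain :: "'a measure \<Rightarrow> (nat \<Rightarrow> 'a \<Rightarrow> 'x) \<Rightarrow> (nat \<Rightarrow> 'x set) \<Rightarrow> bool" where
  "tight_chain M X Xs \<longleftrightarrow>
     (\<lambda>n. SUP t. measure M {\<omega>\<in>space M. X t \<omega> \<notin> Xs n}) \<longlonglongrightarrow> 0"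

text \<open>\<open>\<frakM>_b\<close>: those \<open>\<mu> \<in> \<frakM>_0\<close> such that the chain (in environment \<open>Y\<close>, kernel \<open>Q\<close>)
  started with \<open>\<L>(X_0,(Y_k)_k) = \<mu>\<close> satisfies the tightness condition.  The chain is
  realised on any probability space (with sample space of the same type as \<open>M\<close>);
  its law is determined by \<open>\<mu>\<close> and \<open>Q\<close>, so we quantify over all such chains.\<close>
definition Mb :: "'a measure \<Rightarrow> (int \<Rightarrow> 'a \<Rightarrow> 'y::topological_space)
    \<Rightarrow> ('x::topological_space \<Rightarrow> 'y \<Rightarrow> 'x measure) \<Rightarrow> (nat \<Rightarrow> 'x set)
    \<Rightarrow> ('x \<times> (int \<Rightarrow> 'y)) measure set" where
  "Mb M Y Q Xs = {\<mu> \<in> M0 M Y.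
      \<forall>(N::'a measure) X' Y'. prob_space N \<and> mcre N X' Y' Q \<and> law_at N X' Y' 0 = \<mu>
         \<longrightarrow> tight_chain N X' Xs}"

end

theory Submission
  imports Defs
begin

text \<open>The pair \<open>(X_t, (Y_{t+k})_k)\<close> is a Markov chain on \<open>\<X> \<times> \<Y>^\<int>\<close> whose kernel moves the first
  coordinate by \<open>Q\<close> and shifts the environment. By stationarity all laws involved have the same
  environment marginal, so for \<open>\<bar>\<phi>\<bar> \<le> 1\<close> one may subtract \<open>\<alpha>_n \<integral> \<phi>(x, shift y) \<nu>_n(dx)\<close>, a function of
  the environment alone, from the transition operator applied to \<open>\<phi>\<close> without changing the
  difference of the integrals under two such laws. By minorization the remaining function is bounded
  by \<open>1 - \<alpha>_n\<close> on \<open>\<X>_n \<times> {y_0 \<in> \<Y>_n}\<close> and by \<open>1 + \<alpha>_n\<close> elsewhere, so one step takes the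
  total variation distance \<open>d\<close> to at most \<open>(1 - \<alpha>_n) d + 2 \<alpha>_n b\<close>, where \<open>b\<close> is the mass that the two laws
  put outside this set. Hence the distance after \<open>t\<close> steps is at most \<open>2 (1 - \<alpha>_n)^t + 2 b_n\<close>, with
  \<open>b_n \<rightarrow> 0\<close> by tightness. Applied to two chains this is merging; applied to a chain and its time shifts it is
  the Cauchy property, and the limit is invariant because the kernel contracts total variation.\<close>

section \<open>Total variation distance\<close>

text \<open>Membership in \<open>space (prob_algebra S)\<close> packs two facts, being a probability
  and living on the sigma-algebra of \<open>S\<close>, so it serves as the standing hypothesis on
  laws. The bound is asked at every point of the type, as for the test functions in
  \<open>tv_dist\<close>.\<close>

lemma integrable_bounded_prob_algebra:
  fixes \<phi> :: "'b \<Rightarrow> real"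
  assumes "\<mu> \<in> space (prob_algebra S)" "\<phi> \<in> borel_measurable S" "\<And>z. \<bar>\<phi> z\<bar> \<le> c"
  shows "integrable \<mu> \<phi>"
proof -
  interpret prob_space \<mu> using assms by (simp add: space_prob_algebra)
  have "\<phi> \<in> borel_measurable \<mu>"
    using assms by (simp add: space_prob_algebra cong: measurable_cong_sets)
  then show ?thesis by (intro integrable_const_bound[where B=c]) (use assms in auto)
qed

lemma abs_integral_le_prob_algebra:
  fixes \<phi> :: "'b \<Rightarrow> real"
  assumes "\<mu> \<in> space (prob_algebra S)" "\<phi> \<in> borel_measurable S" "\<And>z. \<bar>\<phi> z\<bar> \<le> c"
  shows "\<bar>\<integral>z. \<phi> z \<partial>\<mu>\<bar> \<le> c"
proof -
  interpret prob_space \<mu> using assms by (simp add: space_prob_algebra)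
  have i: "integrable \<mu> \<phi>" by (rule integrable_bounded_prob_algebra[OF assms])
  have "\<bar>\<integral>z. \<phi> z \<partial>\<mu>\<bar> \<le> (\<integral>z. \<bar>\<phi> z\<bar> \<partial>\<mu>)" by (rule integral_abs_bound)
  also have "\<dots> \<le> (\<integral>z. c \<partial>\<mu>)" using i assms(3) by (intro integral_mono) auto
  finally show ?thesis by (simp add: prob_space)
qed

text \<open>A real supremum dominates its members only if the family is bounded above; here 2 is a
  bound, since each of the two integrals has modulus at most 1.\<close>

lemma tv_dist_ge:
  assumes \<mu>: "\<mu> \<in> space (prob_algebra S)" and \<nu>: "\<nu> \<in> space (prob_algebra S)"
    and \<phi>: "\<phi> \<in> borel_measurable S" "\<And>z. \<bar>\<phi> z\<bar> \<le> 1"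
  shows "\<bar>(\<integral>z. \<phi> z \<partial>\<mu>) - (\<integral>z. \<phi> z \<partial>\<nu>)\<bar> \<le> tv_dist \<mu> \<nu>"
  unfolding tv_dist_def
proof (rule cSUP_upper)
  show "\<phi> \<in> {\<phi> \<in> borel_measurable \<mu>. \<forall>z. \<bar>\<phi> z\<bar> \<le> 1}"
    using \<mu> \<phi> by (simp add: space_prob_algebra cong: measurable_cong_sets)
  show "bdd_above ((\<lambda>\<phi>::_ \<Rightarrow> real. \<bar>(\<integral>z. \<phi> z \<partial>\<mu>) - (\<integral>z. \<phi> z \<partial>\<nu>)\<bar>) `
      {\<phi> \<in> borel_measurable \<mu>. \<forall>z. \<bar>\<phi> z\<bar> \<le> 1})"
  proof (rule bdd_aboveI2)
    fix \<psi> :: "_ \<Rightarrow> real" assume "\<psi> \<in> {\<phi> \<in> borel_measurable \<mu>. \<forall>z. \<bar>\<phi> z\<bar> \<le> 1}"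
    then have \<psi>: "\<psi> \<in> borel_measurable S" "\<And>z. \<bar>\<psi> z\<bar> \<le> 1"
      using \<mu> by (simp_all add: space_prob_algebra cong: measurable_cong_sets)
    show "\<bar>(\<integral>z. \<psi> z \<partial>\<mu>) - (\<integral>z. \<psi> z \<partial>\<nu>)\<bar> \<le> 2"
      using abs_integral_le_prob_algebra[OF \<mu> \<psi>] abs_integral_le_prob_algebra[OF \<nu> \<psi>] by linarith
  qed
qed

lemma tv_dist_leI:
  assumes \<mu>: "\<mu> \<in> space (prob_algebra S)"
    and le: "\<And>\<phi>. \<phi> \<in> borel_measurable S \<Longrightarrow> (\<And>z. \<bar>\<phi> z\<bar> \<le> 1) \<Longrightarrow>
      \<bar>(\<integral>z. \<phi> z \<partial>\<mu>) - (\<integral>z. \<phi> z \<partial>\<nu>)\<bar> \<le> c"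
  shows "tv_dist \<mu> \<nu> \<le> c"
  unfolding tv_dist_def
proof (rule cSUP_least)
  have "(\<lambda>_. 0) \<in> {\<phi> \<in> borel_measurable \<mu>. \<forall>z. \<bar>\<phi> z\<bar> \<le> (1::real)}" by simp
  then show "{\<phi> \<in> borel_measurable \<mu>. \<forall>z. \<bar>\<phi> z\<bar> \<le> (1::real)} \<noteq> {}" by blast
next
  fix \<phi> assume "\<phi> \<in> {\<phi> \<in> borel_measurable \<mu>. \<forall>z. \<bar>\<phi> z\<bar> \<le> (1::real)}"
  then show "\<bar>(\<integral>z. \<phi> z \<partial>\<mu>) - (\<integral>z. \<phi> z \<partial>\<nu>)\<bar> \<le> c"
    using \<mu> by (intro le) (simp_all add: space_prob_algebra cong: measurable_cong_sets)
qed

lemma tv_dist_le_2: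
  assumes \<mu>: "\<mu> \<in> space (prob_algebra S)" and \<nu>: "\<nu> \<in> space (prob_algebra S)"
  shows "tv_dist \<mu> \<nu> \<le> 2"
proof (rule tv_dist_leI[OF \<mu>])
  fix \<psi> :: "_ \<Rightarrow> real" assume \<psi>: "\<psi> \<in> borel_measurable S" "\<And>z. \<bar>\<psi> z\<bar> \<le> 1"
  show "\<bar>(\<integral>z. \<psi> z \<partial>\<mu>) - (\<integral>z. \<psi> z \<partial>\<nu>)\<bar> \<le> 2"
    using abs_integral_le_prob_algebra[OF \<mu> \<psi>] abs_integral_le_prob_algebra[OF \<nu> \<psi>] by linarith
qed

lemma tv_dist_nonneg:
  assumes \<mu>: "\<mu> \<in> space (prob_algebra S)" and \<nu>: "\<nu> \<in> space (prob_algebra S)"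
  shows "0 \<le> tv_dist \<mu> \<nu>"
  using tv_dist_ge[OF \<mu> \<nu>, of "\<lambda>_. 0"] by simp

text \<open>\<open>tv_dist\<close> takes test functions measurable for its first argument only, so
  symmetry rests on the common sigma-algebra of \<open>S\<close>.\<close>

lemma tv_dist_commute:
  assumes \<mu>: "\<mu> \<in> space (prob_algebra S)" and \<nu>: "\<nu> \<in> space (prob_algebra S)"
  shows "tv_dist \<mu> \<nu> = tv_dist \<nu> \<mu>"
proof (rule antisym)
  show "tv_dist \<mu> \<nu> \<le> tv_dist \<nu> \<mu>"
    by (rule tv_dist_leI[OF \<mu>]) (subst abs_minus_commute, rule tv_dist_ge[OF \<nu> \<mu>], auto)
  show "tv_dist \<nu> \<mu> \<le> tv_dist \<mu> \<nu>"
    by (rule tv_dist_leI[OF \<nu>]) (subst abs_minus_commute, rule tv_dist_ge[OF \<mu> \<nu>], auto)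
qed

lemma tv_dist_triangle:
  assumes \<mu>: "\<mu> \<in> space (prob_algebra S)" and \<nu>: "\<nu> \<in> space (prob_algebra S)"
    and \<kappa>: "\<kappa> \<in> space (prob_algebra S)"
  shows "tv_dist \<mu> \<kappa> \<le> tv_dist \<mu> \<nu> + tv_dist \<nu> \<kappa>"
proof (rule tv_dist_leI[OF \<mu>])
  fix \<psi> :: "_ \<Rightarrow> real" assume \<psi>: "\<psi> \<in> borel_measurable S" "\<And>z. \<bar>\<psi> z\<bar> \<le> 1"
  show "\<bar>(\<integral>z. \<psi> z \<partial>\<mu>) - (\<integral>z. \<psi> z \<partial>\<kappa>)\<bar> \<le> tv_dist \<mu> \<nu> + tv_dist \<nu> \<kappa>"
    using tv_dist_ge[OF \<mu> \<nu> \<psi>] tv_dist_ge[OF \<nu> \<kappa> \<psi>] by linarith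
qed

text \<open>Dividing by \<open>c\<close> gives an admissible test function. The degenerate case
  \<open>c = 0\<close> does occur: the lemma is applied with \<open>c = 1 - a\<close>, where
  \<open>a\<close> may be 1.\<close>

lemma tv_dist_ge_scaled:
  assumes \<mu>: "\<mu> \<in> space (prob_algebra S)" and \<nu>: "\<nu> \<in> space (prob_algebra S)"
    and \<phi>: "\<phi> \<in> borel_measurable S" "\<And>z. \<bar>\<phi> z\<bar> \<le> c"
  shows "\<bar>(\<integral>z. \<phi> z \<partial>\<mu>) - (\<integral>z. \<phi> z \<partial>\<nu>)\<bar> \<le> c * tv_dist \<mu> \<nu>"
proof (cases "c = 0")
  case True
  then show ?thesis using \<phi>(2) by simp
next
  case False
  moreover have "0 \<le> c" using \<phi>(2)[of undefined] abs_ge_zero order_trans by blast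
  ultimately have c: "0 < c" by simp
  have "\<bar>(\<integral>z. \<phi> z / c \<partial>\<mu>) - (\<integral>z. \<phi> z / c \<partial>\<nu>)\<bar> \<le> tv_dist \<mu> \<nu>"
    using \<phi> c by (intro tv_dist_ge[OF \<mu> \<nu>]) (auto simp: abs_divide)
  then show ?thesis using c by (simp add: diff_divide_distrib[symmetric] abs_divide field_simps)
qed

lemma measure_diff_le_tv_dist:
  assumes \<mu>: "\<mu> \<in> space (prob_algebra S)" and \<nu>: "\<nu> \<in> space (prob_algebra S)"
    and A: "A \<in> sets S"
  shows "\<bar>measure \<mu> A - measure \<nu> A\<bar> \<le> tv_dist \<mu> \<nu>"
proof -
  have "A \<subseteq> space \<mu>" "A \<subseteq> space \<nu>"
    using \<mu> \<nu> A by (auto simp: space_prob_algebra dest: sets.sets_into_space sets_eq_imp_space_eq)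
  then have "(\<integral>z. indicator A z \<partial>\<mu>) = measure \<mu> A" "(\<integral>z. indicator A z \<partial>\<nu>) = measure \<nu> A"
    by (simp_all add: Int_absorb2)
  with tv_dist_ge[OF \<mu> \<nu>, of "indicator A"] A show ?thesis
    by (simp add: indicator_def of_bool_def)
qed

text \<open>Indicators are test functions, so the two measures agree set by set. This turns a
  vanishing distance into the invariance of the limit law.\<close>

lemma tv_dist_le_0_imp_eq:
  assumes \<mu>: "\<mu> \<in> space (prob_algebra S)" and \<nu>: "\<nu> \<in> space (prob_algebra S)"
    and le: "tv_dist \<mu> \<nu> \<le> 0"
  shows "\<mu> = \<nu>"
proof (rule measure_eqI)
  show "sets \<mu> = sets \<nu>" using \<mu> \<nu> by (simp add: space_prob_algebra)
  fix A assume "A \<in> sets \<mu>"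
  then have "A \<in> sets S" using \<mu> by (simp add: space_prob_algebra)
  from measure_diff_le_tv_dist[OF \<mu> \<nu> this] le have "measure \<mu> A = measure \<nu> A" by simp
  moreover have "finite_measure \<mu>" "finite_measure \<nu>"
    using \<mu> \<nu> by (auto simp: space_prob_algebra intro: prob_space.finite_measure)
  ultimately show "emeasure \<mu> A = emeasure \<nu> A"
    by (simp add: finite_measure.emeasure_eq_measure)
qed

section \<open>Probabilities pushed through a kernel\<close>

lemma bind_in_prob_algebra:
  assumes "\<mu> \<in> space (prob_algebra S)" "K \<in> S \<rightarrow>\<^sub>M prob_algebra R"
  shows "\<mu> \<bind> K \<in> space (prob_algebra R)"
  using prob_space_bind'[OF assms] sets_bind'[OF assms] by (simp add: space_prob_algebra)

lemma integral_bind_prob_algebra: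
  fixes \<phi> :: "'c \<Rightarrow> real"
  assumes \<mu>: "\<mu> \<in> space (prob_algebra S)" and K: "K \<in> S \<rightarrow>\<^sub>M prob_algebra R"
    and \<phi>: "\<phi> \<in> borel_measurable R" "\<And>z. \<bar>\<phi> z\<bar> \<le> c"
  shows "(\<integral>z. \<phi> z \<partial>(\<mu> \<bind> K)) = (\<integral>z. \<integral>w. \<phi> w \<partial>K z \<partial>\<mu>)"
proof (rule integral_bind[where K=R and B=c and B'=1])
  show "finite_measure \<mu>" using \<mu> by (simp add: space_prob_algebra prob_space.finite_measure)
  have K': "K \<in> \<mu> \<rightarrow>\<^sub>M prob_algebra R"
    using K \<mu> by (simp add: space_prob_algebra cong: measurable_cong_sets)
  then show "K \<in> \<mu> \<rightarrow>\<^sub>M subprob_algebra R" by (rule measurable_prob_algebraD)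
  show "AE x in \<mu>. emeasure (K x) (space (K x)) \<le> ennreal 1"
    using measurable_space[OF K'] by (intro AE_I2) (simp add: space_prob_algebra prob_space.emeasure_space_1)
qed (use \<phi> in auto)

lemma measurable_integral_kernel:
  fixes \<phi> :: "'c \<Rightarrow> real"
  assumes "K \<in> S \<rightarrow>\<^sub>M prob_algebra R" "\<phi> \<in> borel_measurable R"
  shows "(\<lambda>z. \<integral>w. \<phi> w \<partial>K z) \<in> borel_measurable S"
  using measurable_compose[OF measurable_prob_algebraD[OF assms(1)]
      integral_measurable_subprob_algebra[OF assms(2)]] .

text \<open>Averaging a test function against the kernel yields a test function again. With
  \<open>space S = UNIV\<close>, every \<open>K z\<close> is a probability, so the average is
  bounded by 1 at every point of the type.\<close>

lemma tv_dist_bind_le: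
  assumes \<mu>: "\<mu> \<in> space (prob_algebra S)" and \<nu>: "\<nu> \<in> space (prob_algebra S)"
    and K: "K \<in> S \<rightarrow>\<^sub>M prob_algebra R" and S: "space S = UNIV"
  shows "tv_dist (\<mu> \<bind> K) (\<nu> \<bind> K) \<le> tv_dist \<mu> \<nu>"
proof (rule tv_dist_leI[OF bind_in_prob_algebra[OF \<mu> K]])
  fix \<phi> :: "_ \<Rightarrow> real" assume \<phi>: "\<phi> \<in> borel_measurable R" "\<And>z. \<bar>\<phi> z\<bar> \<le> 1"
  have "K z \<in> space (prob_algebra R)" for z
    using measurable_space[OF K] S by simp
  then show "\<bar>(\<integral>z. \<phi> z \<partial>(\<mu> \<bind> K)) - (\<integral>z. \<phi> z \<partial>(\<nu> \<bind> K))\<bar> \<le> tv_dist \<mu> \<nu>"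
    unfolding integral_bind_prob_algebra[OF \<mu> K \<phi>] integral_bind_prob_algebra[OF \<nu> K \<phi>]
    by (intro tv_dist_ge[OF \<mu> \<nu> measurable_integral_kernel[OF K \<phi>(1)]]
        abs_integral_le_prob_algebra[OF _ \<phi>])
qed

section \<open>Completeness in total variation\<close>

text \<open>A bounded measurable function is a uniform limit of step functions, whose integrals are
  finite combinations of measures of sets. This is needed because the limit measure below is first
  known only set by set.\<close>

lemma integral_tendsto_of_setwise:
  fixes \<phi> :: "'b \<Rightarrow> real"
  assumes m: "\<And>s. m s \<in> space (prob_algebra S)" and \<mu>: "\<mu> \<in> space (prob_algebra S)"
    and lim: "\<And>A. A \<in> sets S \<Longrightarrow> (\<lambda>s::nat. measure (m s) A) \<longlonglongrightarrow> measure \<mu> A"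
    and \<phi>: "\<phi> \<in> borel_measurable S" "\<And>z. \<bar>\<phi> z\<bar> \<le> 1"
  shows "(\<lambda>s. \<integral>z. \<phi> z \<partial>m s) \<longlonglongrightarrow> (\<integral>z. \<phi> z \<partial>\<mu>)"
proof (rule LIMSEQ_I)
  fix r :: real assume r: "0 < r"
  \<comment> \<open>With this \<open>N\<close>, three errors of size \<open>1 / N\<close> stay below
    \<open>r\<close>: two from replacing \<phi> by a step function and one from the convergence of
    the step integrals.\<close>
  obtain N :: nat where N: "3 / r < real N" using reals_Archimedean2 by blast
  with r have N0: "0 < real N" by (smt (verit) divide_pos_pos)
  define E where "E j = {z \<in> space S. \<lfloor>real N * \<phi> z\<rfloor> = j}" for j
  have E[measurable]: "E j \<in> sets S" for j unfolding E_def using \<phi>(1) by measurable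
  \<comment> \<open>Rounds \<phi> down to a multiple of \<open>1 / N\<close>. Since \<phi> lies
    between -1 and 1, the levels from \<open>-N\<close> to \<open>N\<close> cover all its values,
    and only finitely many sets are involved.\<close>
  define \<psi> where "\<psi> z = (\<Sum>j\<in>{-int N..int N}. (of_int j / real N) * indicator (E j) z)" for z
  have \<psi>: "\<bar>\<phi> z - \<psi> z\<bar> \<le> 1 / real N" if "z \<in> space S" for z
  proof -
    have "real N * \<phi> z \<le> real N" "- real N \<le> real N * \<phi> z"
      using mult_left_mono[of "\<phi> z" 1 "real N"] mult_left_mono[of "-1" "\<phi> z" "real N"] \<phi>(2)[of z] N0
      by (simp_all add: abs_le_iff)
    then have "\<lfloor>real N * \<phi> z\<rfloor> \<in> {-int N..int N}"
      by (auto simp: floor_le_iff le_floor_iff)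
    \<comment> \<open>The sets \<open>E j\<close> are disjoint, so a single term of the sum
      survives.\<close>
    then have "\<psi> z = of_int \<lfloor>real N * \<phi> z\<rfloor> / real N"
      unfolding \<psi>_def E_def using that by (simp add: indicator_def of_bool_def if_distrib cong: if_cong)
    then have "\<phi> z - \<psi> z = (real N * \<phi> z - of_int \<lfloor>real N * \<phi> z\<rfloor>) / real N"
      using N0 by (simp add: field_simps)
    moreover have "\<bar>real N * \<phi> z - of_int \<lfloor>real N * \<phi> z\<rfloor>\<bar> \<le> 1" by linarith
    ultimately show ?thesis using N0 by (simp only: abs_divide abs_of_nat divide_right_mono of_nat_0_le_iff)
  qed
  have ind: "integrable \<kappa> (\<lambda>z. c * indicator (E j) z :: real)"
    "(\<integral>z. indicator (E j) z \<partial>\<kappa>) = measure \<kappa> (E j)"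
    if "\<kappa> \<in> space (prob_algebra S)" for \<kappa> j c
  proof -
    interpret prob_space \<kappa> using that by (simp add: space_prob_algebra)
    have s: "sets \<kappa> = sets S" using that by (simp add: space_prob_algebra)
    have "E j \<in> sets \<kappa>" using s E by simp
    then show "integrable \<kappa> (\<lambda>z. c * indicator (E j) z :: real)"
      by (intro integrable_mult_right) (simp add: integrable_indicator_iff emeasure_eq_measure)
    show "(\<integral>z. indicator (E j) z \<partial>\<kappa>) = measure \<kappa> (E j)"
      using sets.sets_into_space[OF \<open>E j \<in> sets \<kappa>\<close>] by (simp add: Int_absorb2)
  qed
  have int_\<psi>: "(\<integral>z. \<psi> z \<partial>\<kappa>) = (\<Sum>j\<in>{-int N..int N}. (of_int j / real N) * measure \<kappa> (E j))"
    "integrable \<kappa> \<psi>"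
    if "\<kappa> \<in> space (prob_algebra S)" for \<kappa>
  proof -
    show "integrable \<kappa> \<psi>"
      unfolding \<psi>_def by (intro Bochner_Integration.integrable_sum ind[OF that])
    show "(\<integral>z. \<psi> z \<partial>\<kappa>) = (\<Sum>j\<in>{-int N..int N}. (of_int j / real N) * measure \<kappa> (E j))"
      unfolding \<psi>_def
      by (subst Bochner_Integration.integral_sum) (auto intro: ind(1)[OF that] simp only: integral_mult_right_zero ind(2)[OF that])
  qed
  have approx: "\<bar>(\<integral>z. \<phi> z \<partial>\<kappa>) - (\<integral>z. \<psi> z \<partial>\<kappa>)\<bar> \<le> 1 / real N"
    if \<kappa>: "\<kappa> \<in> space (prob_algebra S)" for \<kappa>
  proof -
    interpret prob_space \<kappa> using that by (simp add: space_prob_algebra)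
    have sp: "space \<kappa> = space S"
      using that sets_eq_imp_space_eq[of \<kappa> S] by (simp add: space_prob_algebra)
    have i: "integrable \<kappa> \<phi>" by (rule integrable_bounded_prob_algebra[OF \<kappa> \<phi>])
    have "\<bar>(\<integral>z. \<phi> z \<partial>\<kappa>) - (\<integral>z. \<psi> z \<partial>\<kappa>)\<bar> = \<bar>\<integral>z. \<phi> z - \<psi> z \<partial>\<kappa>\<bar>"
      using i int_\<psi>(2)[OF \<kappa>] by simp
    also have "\<dots> \<le> (\<integral>z. \<bar>\<phi> z - \<psi> z\<bar> \<partial>\<kappa>)" by (rule integral_abs_bound)
    also have "\<dots> \<le> (\<integral>z. 1 / real N \<partial>\<kappa>)"
      using i int_\<psi>(2)[OF \<kappa>] \<psi> sp by (intro integral_mono) auto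
    finally show ?thesis by (simp add: prob_space)
  qed
  have "(\<lambda>s. \<integral>z. \<psi> z \<partial>m s) \<longlonglongrightarrow> (\<integral>z. \<psi> z \<partial>\<mu>)"
    unfolding int_\<psi>(1)[OF m] int_\<psi>(1)[OF \<mu>] by (intro tendsto_intros lim E)
  then obtain n0 where n0: "\<And>s. s \<ge> n0 \<Longrightarrow> \<bar>(\<integral>z. \<psi> z \<partial>m s) - (\<integral>z. \<psi> z \<partial>\<mu>)\<bar> < 1 / real N"
    using LIMSEQ_D[of _ _ "1 / real N"] N0 by fastforce
  have "3 / real N < r" using N N0 r by (simp add: field_simps)
  then have "norm ((\<integral>z. \<phi> z \<partial>m s) - (\<integral>z. \<phi> z \<partial>\<mu>)) < r" if "s \<ge> n0" for s
    using approx[OF m, of s] approx[OF \<mu>] n0[OF that] unfolding real_norm_def by linarith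
  then show "\<exists>n0. \<forall>s\<ge>n0. norm ((\<integral>z. \<phi> z \<partial>m s) - (\<integral>z. \<phi> z \<partial>\<mu>)) < r" by blast
qed

text \<open>The measures of each fixed set form a real Cauchy sequence, and their limits define the
  new measure. The Cauchy property is uniform over sets, which gives countable additivity of the
  limit.\<close>

lemma tv_dist_complete:
  fixes m :: "nat \<Rightarrow> 'b measure"
  assumes m: "\<And>t. m t \<in> space (prob_algebra S)"
    and Cauchy: "\<And>e. 0 < e \<Longrightarrow> \<exists>T. \<forall>s\<ge>T. \<forall>t\<ge>T. tv_dist (m s) (m t) \<le> e"
  shows "\<exists>\<mu>. \<mu> \<in> space (prob_algebra S) \<and> (\<lambda>t. tv_dist (m t) \<mu>) \<longlonglongrightarrow> 0"
proof -
  have pm: "prob_space (m t)" and sm: "sets (m t) = sets S" and spm: "space (m t) = space S" for t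
    using m[of t] sets_eq_imp_space_eq[of "m t" S] by (simp_all add: space_prob_algebra)
  define L where "L A = lim (\<lambda>t. measure (m t) A)" for A
  have L: "(\<lambda>t. measure (m t) A) \<longlonglongrightarrow> L A" if A: "A \<in> sets S" for A
  proof -
    have "Cauchy (\<lambda>t. measure (m t) A)"
    proof (rule metric_CauchyI)
      fix e :: real assume "0 < e"
      then obtain T where T: "\<And>s t. s \<ge> T \<Longrightarrow> t \<ge> T \<Longrightarrow> tv_dist (m s) (m t) \<le> e / 2"
        using Cauchy[of "e / 2"] by auto
      have "dist (measure (m s) A) (measure (m t) A) < e" if "s \<ge> T" "t \<ge> T" for s t
        using measure_diff_le_tv_dist[OF m m A, of s t] T[OF that] \<open>0 < e\<close>
        unfolding dist_real_def by linarith
      then show "\<exists>T. \<forall>s\<ge>T. \<forall>t\<ge>T. dist (measure (m s) A) (measure (m t) A) < e" by blast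
    qed
    then show ?thesis
      unfolding L_def by (simp add: Cauchy_convergent_iff convergent_LIMSEQ_iff)
  qed
  have L_nonneg: "0 \<le> L A" if "A \<in> sets S" for A
    by (rule LIMSEQ_le_const[OF L[OF that]]) simp
  \<comment> \<open>A one-sided bound by a single \<open>m T\<close>, uniform in \<open>A\<close>,
    is enough: on sets decreasing to the empty set, \<open>m T\<close> tends to 0, so the limit of
    \<open>L\<close> is at most \<open>e\<close> for every \<open>e\<close>.\<close>
  have L_unif: "\<exists>T. \<forall>A\<in>sets S. L A \<le> measure (m T) A + e" if e: "0 < e" for e
  proof -
    obtain T where T: "\<And>s t. s \<ge> T \<Longrightarrow> t \<ge> T \<Longrightarrow> tv_dist (m s) (m t) \<le> e"
      using Cauchy[OF e] by auto
    have "L A \<le> measure (m T) A + e" if A: "A \<in> sets S" for A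
    proof (rule LIMSEQ_le_const2[OF L[OF A]], intro exI allI impI)
      fix s assume "T \<le> s"
      then show "measure (m s) A \<le> measure (m T) A + e"
        using measure_diff_le_tv_dist[OF m m A, of s T] T[of s T] by linarith
    qed
    then show ?thesis by blast
  qed
  \<comment> \<open>Finite additivity passes to the limit directly; with continuity at the empty set
    it becomes countable additivity.\<close>
  have "countably_additive (sets S) (\<lambda>A. ennreal (L A))"
  proof (rule sets.empty_continuous_imp_countably_additive)
    have "L {} = 0" unfolding L_def by simp
    then show "positive (sets S) (\<lambda>A. ennreal (L A))" by (simp add: positive_def)
    show "additive (sets S) (\<lambda>A. ennreal (L A))"
      unfolding additive_def
    proof (intro ballI impI)
      fix A B assume AB: "A \<in> sets S" "B \<in> sets S" "A \<inter> B = {}"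
      have "measure (m t) (A \<union> B) = measure (m t) A + measure (m t) B" for t
        using AB pm by (intro finite_measure.finite_measure_Union)
          (auto simp: sm prob_space.finite_measure)
      then have "(\<lambda>t. measure (m t) (A \<union> B)) \<longlonglongrightarrow> L A + L B"
        using tendsto_add[OF L[OF AB(1)] L[OF AB(2)]] by simp
      with L[of "A \<union> B"] AB have "L (A \<union> B) = L A + L B" using LIMSEQ_unique by blast
      then show "ennreal (L (A \<union> B)) = ennreal (L A) + ennreal (L B)"
        using L_nonneg AB by simp
    qed
    show "\<forall>A\<in>sets S. ennreal (L A) \<noteq> \<infinity>" by simp
    fix A :: "nat \<Rightarrow> 'b set"
    assume A: "range A \<subseteq> sets S" "decseq A" "(\<Inter>i. A i) = {}"
    have "(\<lambda>i. L (A i)) \<longlonglongrightarrow> 0"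
    proof (rule LIMSEQ_I)
      fix r :: real assume r: "0 < r"
      then obtain T where T: "\<And>A. A \<in> sets S \<Longrightarrow> L A \<le> measure (m T) A + r / 2"
        using L_unif[of "r / 2"] by auto
      have "(\<lambda>i. measure (m T) (A i)) \<longlonglongrightarrow> measure (m T) (\<Inter>i. A i)"
        using A pm by (intro finite_measure.finite_Lim_measure_decseq)
          (auto simp: sm prob_space.finite_measure)
      then have "(\<lambda>i. measure (m T) (A i)) \<longlonglongrightarrow> 0" using A by simp
      then obtain n0 where n0: "\<And>i. i \<ge> n0 \<Longrightarrow> measure (m T) (A i) < r / 2"
        using LIMSEQ_D[of _ 0 "r / 2"] r by fastforce
      have "norm (L (A i) - 0) < r" if "i \<ge> n0" for i
        using n0[OF that] T[of "A i"] L_nonneg[of "A i"] A(1) by auto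
      then show "\<exists>n0. \<forall>i\<ge>n0. norm (L (A i) - 0) < r" by blast
    qed
    then show "(\<lambda>i. ennreal (L (A i))) \<longlonglongrightarrow> 0"
      using tendsto_ennrealI by fastforce
  qed
  moreover define \<mu> where "\<mu> = measure_of (space S) (sets S) (\<lambda>A. ennreal (L A))"
  moreover have "positive (sets S) (\<lambda>A. ennreal (L A))" unfolding L_def by (simp add: positive_def)
  ultimately have em: "emeasure \<mu> A = ennreal (L A)" if "A \<in> sets S" for A
    using that unfolding \<mu>_def by (intro emeasure_measure_of_sigma sets.sigma_algebra_axioms)
  have s\<mu>: "sets \<mu> = sets S" and sp\<mu>: "space \<mu> = space S" by (simp_all add: \<mu>_def)
  have me: "measure \<mu> A = L A" if "A \<in> sets S" for A
    using em[OF that] L_nonneg[OF that] by (simp add: measure_def)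
  have "L (space S) = 1"
  proof -
    have "measure (m t) (space S) = 1" for t using prob_space.prob_space[OF pm, of t] by (simp add: spm)
    then show ?thesis unfolding L_def by simp
  qed
  then have "prob_space \<mu>" by (intro prob_spaceI) (simp add: sp\<mu> em)
  then have \<mu>: "\<mu> \<in> space (prob_algebra S)" by (simp add: space_prob_algebra s\<mu>)
  have "(\<lambda>t. tv_dist (m t) \<mu>) \<longlonglongrightarrow> 0"
  proof (rule LIMSEQ_I)
    fix e :: real assume e: "0 < e"
    then obtain T where T: "\<And>s t. s \<ge> T \<Longrightarrow> t \<ge> T \<Longrightarrow> tv_dist (m s) (m t) \<le> e / 2"
      using Cauchy[of "e / 2"] by auto
    \<comment> \<open>For one fixed test function the Cauchy estimate between times \<open>t\<close>
      and \<open>s\<close> survives letting \<open>s\<close> tend to infinity. Using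
      \<open>e / 2\<close> leaves room for the strict inequality.\<close>
    have "tv_dist (m t) \<mu> \<le> e / 2" if t: "t \<ge> T" for t
    proof (rule tv_dist_leI[OF m])
      fix \<phi> :: "'b \<Rightarrow> real" assume \<phi>: "\<phi> \<in> borel_measurable S" "\<And>z. \<bar>\<phi> z\<bar> \<le> 1"
      have "(\<lambda>s. \<bar>(\<integral>z. \<phi> z \<partial>m t) - (\<integral>z. \<phi> z \<partial>m s)\<bar>) \<longlonglongrightarrow> \<bar>(\<integral>z. \<phi> z \<partial>m t) - (\<integral>z. \<phi> z \<partial>\<mu>)\<bar>"
        by (intro tendsto_intros integral_tendsto_of_setwise[OF m \<mu> _ \<phi>]) (simp add: me L)
      then show "\<bar>(\<integral>z. \<phi> z \<partial>m t) - (\<integral>z. \<phi> z \<partial>\<mu>)\<bar> \<le> e / 2"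
      proof (rule LIMSEQ_le_const2, intro exI allI impI)
        fix s assume "T \<le> s"
        then show "\<bar>(\<integral>z. \<phi> z \<partial>m t) - (\<integral>z. \<phi> z \<partial>m s)\<bar> \<le> e / 2"
          using tv_dist_ge[OF m m \<phi>, of t s] T[OF t, of s] by linarith
      qed
    qed
    then show "\<exists>T. \<forall>t\<ge>T. norm (tv_dist (m t) \<mu> - 0) < e"
      using tv_dist_nonneg[OF m \<mu>] e by (intro exI[of _ T]) fastforce
  qed
  with \<mu> show ?thesis by blast
qed

text \<open>By minorization \<open>\<kappa> - a \<nu>\<close> is a nonnegative measure of total mass
  \<open>1 - a\<close>. Instead of forming this difference, the proof compares integrals of the
  nonnegative functions \<open>1 - f\<close> and \<open>1 + f\<close>.\<close>

lemma minorized_integral_diff_le: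
  fixes f :: "'b \<Rightarrow> real"
  assumes \<kappa>: "\<kappa> \<in> space (prob_algebra S)" and \<nu>: "\<nu> \<in> space (prob_algebra S)" and a: "0 \<le> a"
    and minor: "\<And>A. A \<in> sets S \<Longrightarrow> a * measure \<nu> A \<le> measure \<kappa> A"
    and f: "f \<in> borel_measurable S" "\<And>z. \<bar>f z\<bar> \<le> 1"
  shows "\<bar>(\<integral>z. f z \<partial>\<kappa>) - a * (\<integral>z. f z \<partial>\<nu>)\<bar> \<le> 1 - a"
proof -
  interpret \<kappa>: prob_space \<kappa> using \<kappa> by (simp add: space_prob_algebra)
  interpret \<nu>: prob_space \<nu> using \<nu> by (simp add: space_prob_algebra)
  have s[measurable_cong]: "sets \<kappa> = sets S" "sets \<nu> = sets S"
    using \<kappa> \<nu> by (auto simp: space_prob_algebra)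
  have le: "scale_measure (ennreal a) \<nu> \<le> \<kappa>"
    using minor a by (subst le_measure)
      (auto simp: s \<kappa>.emeasure_eq_measure \<nu>.emeasure_eq_measure ennreal_mult[symmetric] intro!: ennreal_leI)
  \<comment> \<open>The upper bound 2 fits the two instances \<open>1 - f\<close> and
    \<open>1 + f\<close> and serves to make \<open>g\<close> integrable.\<close>
  have *: "a * (\<integral>z. g z \<partial>\<nu>) \<le> (\<integral>z. g z \<partial>\<kappa>)"
    if g[measurable]: "g \<in> borel_measurable S" and g0: "\<And>z. 0 \<le> g z" and g2: "\<And>z. g z \<le> 2"
    for g :: "'b \<Rightarrow> real"
  proof -
    have b: "\<And>z. \<bar>g z\<bar> \<le> 2" using g0 g2 by simp
    have i: "integrable \<kappa> g" "integrable \<nu> g"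
      using integrable_bounded_prob_algebra[OF _ g b] \<kappa> \<nu> by auto
    have "ennreal (a * (\<integral>z. g z \<partial>\<nu>)) = ennreal a * (\<integral>\<^sup>+z. ennreal (g z) \<partial>\<nu>)"
      using i g0 a by (simp add: nn_integral_eq_integral ennreal_mult)
    also have "\<dots> = (\<integral>\<^sup>+z. ennreal (g z) \<partial>scale_measure (ennreal a) \<nu>)"
      by (subst nn_integral_scale_measure) auto
    also have "\<dots> \<le> (\<integral>\<^sup>+z. ennreal (g z) \<partial>\<kappa>)"
      by (rule nn_integral_mono_measure[OF _ le]) (simp add: s)
    also have "\<dots> = ennreal (\<integral>z. g z \<partial>\<kappa>)"
      using i g0 by (simp add: nn_integral_eq_integral)
    finally show ?thesis using g0 by (subst (asm) ennreal_le_iff) auto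
  qed
  have f': "-1 \<le> f z" "f z \<le> 1" for z using f(2)[of z] by auto
  have i: "integrable \<kappa> f" "integrable \<nu> f"
    using integrable_bounded_prob_algebra[OF _ f] \<kappa> \<nu> by auto
  have "a * (\<integral>z. 1 - f z \<partial>\<nu>) \<le> (\<integral>z. 1 - f z \<partial>\<kappa>)" "a * (\<integral>z. 1 + f z \<partial>\<nu>) \<le> (\<integral>z. 1 + f z \<partial>\<kappa>)"
    using f(1) f' by (intro *; simp add: add.commute diff_le_eq; smt (verit))+
  then show ?thesis using i by (simp add: abs_le_iff algebra_simps \<kappa>.prob_space \<nu>.prob_space)
qed

section \<open>The kernel of the chain with its environment\<close>

text \<open>Only the first coordinate is random, and coordinate 0 of the environment drives it. The
  shift recentres the environment at the next time, in agreement with the recentred paths in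
  \<open>law_at\<close>.\<close>

definition step_kernel :: "('x::topological_space \<Rightarrow> 'y::topological_space \<Rightarrow> 'x measure)
    \<Rightarrow> 'x \<times> (int \<Rightarrow> 'y) \<Rightarrow> ('x \<times> (int \<Rightarrow> 'y)) measure" where
  "step_kernel Q z = distr (Q (fst z) (snd z 0)) (stateM TYPE('x) TYPE('y))
     (\<lambda>x. (x, \<lambda>k. snd z (k + 1)))"

lemma space_envM: "space (envM TYPE('y::topological_space)) = UNIV"
  by (simp add: space_PiM PiE_UNIV_domain)

lemma space_stateM: "space (stateM TYPE('x::topological_space) TYPE('y::topological_space)) = UNIV"
  by (simp add: space_pair_measure space_envM)

lemma param_kernel_in_prob_algebra:
  assumes "param_kernel (Q :: 'x::topological_space \<Rightarrow> 'y::topological_space \<Rightarrow> 'x measure)"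
  shows "Q x y \<in> space (prob_algebra borel)"
  using assms unfolding param_kernel_def space_prob_algebra by blast

text \<open>Measurability into the space of probabilities is tested by evaluation at Borel sets;
  \<open>param_kernel\<close> provides it in the pair of current state and current environment
  value.\<close>

lemma measurable_param_kernel:
  fixes Q :: "'x::topological_space \<Rightarrow> 'y::topological_space \<Rightarrow> 'x measure"
  assumes Q: "param_kernel Q"
  shows "(\<lambda>z. Q (fst z) (snd z 0)) \<in> stateM TYPE('x) TYPE('y) \<rightarrow>\<^sub>M prob_algebra borel"
proof (rule measurable_prob_algebraI)
  have pQ: "prob_space (Q x y)" "sets (Q x y) = sets borel" for x y
    using Q unfolding param_kernel_def by blast+
  show "prob_space (Q (fst z) (snd z 0))" for z :: "'x \<times> (int \<Rightarrow> 'y)" by (rule pQ)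
  show "(\<lambda>z. Q (fst z) (snd z 0)) \<in> stateM TYPE('x) TYPE('y) \<rightarrow>\<^sub>M subprob_algebra borel"
  proof (rule measurable_subprob_algebra)
    fix A :: "'x set" assume "A \<in> sets borel"
    then have 1: "(\<lambda>(x, y). measure (Q x y) A) \<in> borel_measurable (borel \<Otimes>\<^sub>M borel)"
      using Q unfolding param_kernel_def by blast
    have 2: "(\<lambda>z. (fst z, snd z 0)) \<in> stateM TYPE('x) TYPE('y) \<rightarrow>\<^sub>M borel \<Otimes>\<^sub>M borel"
      by measurable
    have "(\<lambda>z. ennreal (measure (Q (fst z) (snd z 0)) A)) \<in> borel_measurable (stateM TYPE('x) TYPE('y))"
      using measurable_compose[OF measurable_compose[OF 2 1] measurable_ennreal]
      by (simp only: case_prod_conv)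
    then show "(\<lambda>z. emeasure (Q (fst z) (snd z 0)) A) \<in> borel_measurable (stateM TYPE('x) TYPE('y))"
      by (simp only: finite_measure.emeasure_eq_measure[OF prob_space.finite_measure[OF pQ(1)]])
  qed (rule prob_space_imp_subprob_space pQ)+
qed

lemma measurable_step_kernel:
  fixes Q :: "'x::topological_space \<Rightarrow> 'y::topological_space \<Rightarrow> 'x measure"
  assumes Q: "param_kernel Q"
  shows "step_kernel Q \<in> stateM TYPE('x) TYPE('y) \<rightarrow>\<^sub>M prob_algebra (stateM TYPE('x) TYPE('y))"
proof -
  have [measurable]: "(\<lambda>z k. snd (fst z) (k + 1)) \<in> stateM TYPE('x) TYPE('y) \<Otimes>\<^sub>M (borel :: 'x measure) \<rightarrow>\<^sub>M envM TYPE('y)"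
    by (rule measurable_PiM_single') (auto simp: space_PiM PiE_UNIV_domain)
  show ?thesis
    unfolding step_kernel_def[abs_def]
    by (rule measurable_distr_prob_space2[OF measurable_param_kernel[OF Q]])
      (simp add: case_prod_beta')
qed

lemma integral_step_kernel:
  fixes Q :: "'x::topological_space \<Rightarrow> 'y::topological_space \<Rightarrow> 'x measure"
    and \<phi> :: "'x \<times> (int \<Rightarrow> 'y) \<Rightarrow> real"
  assumes Q: "param_kernel Q" and \<phi>: "\<phi> \<in> borel_measurable (stateM TYPE('x) TYPE('y))"
  shows "(\<integral>w. \<phi> w \<partial>step_kernel Q z) = (\<integral>x. \<phi> (x, \<lambda>k. snd z (k + 1)) \<partial>Q (fst z) (snd z 0))"
  unfolding step_kernel_def
proof (rule integral_distr[OF _ \<phi>])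
  have "sets (Q (fst z) (snd z 0)) = sets borel" using Q unfolding param_kernel_def by blast
  then show "(\<lambda>x. (x, \<lambda>k. snd z (k + 1))) \<in> Q (fst z) (snd z 0) \<rightarrow>\<^sub>M stateM TYPE('x) TYPE('y)"
    by (simp add: space_PiM PiE_UNIV_domain cong: measurable_cong_sets)
qed

text \<open>Since \<open>\<mu>\<close> and \<open>\<mu>'\<close> have the same environment marginal, subtracting the function
  \<open>y \<mapsto> a * \<integral> \<phi>(x, shift y) \<nu>(dx)\<close> of the environment alone does not change the difference of
  the integrals, but shrinks the integrand to \<open>[a - 1, 1 - a]\<close> on \<open>C \<times> {y. y 0 \<in> D}\<close>.\<close>

lemma tv_dist_step_kernel_le:
  fixes Q :: "'x::topological_space \<Rightarrow> 'y::topological_space \<Rightarrow> 'x measure"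
  defines "S \<equiv> stateM TYPE('x) TYPE('y)"
  assumes Q: "param_kernel Q"
    and \<mu>: "\<mu> \<in> space (prob_algebra S)" and \<mu>': "\<mu>' \<in> space (prob_algebra S)"
    and marg: "distr \<mu> (envM TYPE('y)) snd = distr \<mu>' (envM TYPE('y)) snd"
    and C: "C \<in> sets borel" and D: "D \<in> sets borel"
    and a: "0 \<le> a" "a \<le> 1" and \<nu>: "\<nu> \<in> space (prob_algebra borel)"
    and minor: "\<And>x y A. x \<in> C \<Longrightarrow> y \<in> D \<Longrightarrow> A \<in> sets borel \<Longrightarrow> a * measure \<nu> A \<le> measure (Q x y) A"
  shows "tv_dist (\<mu> \<bind> step_kernel Q) (\<mu>' \<bind> step_kernel Q) \<le> (1 - a) * tv_dist \<mu> \<mu>'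
    + 2 * a * (measure \<mu> {z. fst z \<notin> C \<or> snd z 0 \<notin> D} + measure \<mu>' {z. fst z \<notin> C \<or> snd z 0 \<notin> D})"
proof -
  have K: "step_kernel Q \<in> S \<rightarrow>\<^sub>M prob_algebra S" unfolding S_def by (rule measurable_step_kernel[OF Q])
  interpret \<nu>: prob_space \<nu> using \<nu> by (simp add: space_prob_algebra)
  have s\<nu>[measurable_cong]: "sets \<nu> = sets borel" using \<nu> by (simp add: space_prob_algebra)
  have sp: "space S = UNIV" unfolding S_def by (rule space_stateM)
  define Bad where "Bad = {z :: 'x \<times> (int \<Rightarrow> 'y). fst z \<notin> C \<or> snd z 0 \<notin> D}"
  have "{z \<in> space S. fst z \<notin> C \<or> snd z 0 \<notin> D} \<in> sets S"
    using C D unfolding S_def by measurable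
  then have Bad: "Bad \<in> sets S" unfolding Bad_def using sp by simp
  show ?thesis unfolding Bad_def[symmetric]
  proof (rule tv_dist_leI[OF bind_in_prob_algebra[OF \<mu> K]])
    fix \<phi> :: "'x \<times> (int \<Rightarrow> 'y) \<Rightarrow> real"
    assume \<phi>: "\<phi> \<in> borel_measurable S" "\<And>z. \<bar>\<phi> z\<bar> \<le> 1"
    \<comment> \<open>The part of the transition that minorization makes independent of the state:
      the new state is drawn from \<nu> and the environment is shifted.\<close>
    define g where "g y = (\<integral>x. \<phi> (x, \<lambda>k. y (k + 1)) \<partial>\<nu>)" for y
    have [measurable]: "(\<lambda>z k. fst z (k + 1)) \<in> envM TYPE('y) \<Otimes>\<^sub>M (borel::'x measure) \<rightarrow>\<^sub>M envM TYPE('y)"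
      by (rule measurable_PiM_single') (auto simp: space_PiM PiE_UNIV_domain)
    have "(\<lambda>z. \<phi> (snd z, \<lambda>k. fst z (k + 1))) \<in> borel_measurable (envM TYPE('y) \<Otimes>\<^sub>M (borel::'x measure))"
      using \<phi>(1) unfolding S_def by measurable
    then have "(\<lambda>(y, x). \<phi> (x, \<lambda>k. y (k + 1))) \<in> borel_measurable (envM TYPE('y) \<Otimes>\<^sub>M \<nu>)"
      by (simp only: case_prod_beta' measurable_cong_sets[OF sets_pair_measure_cong[OF refl s\<nu>] refl])
    then have g: "g \<in> borel_measurable (envM TYPE('y))"
      unfolding g_def by (rule \<nu>.borel_measurable_lebesgue_integral)
    have sec: "(\<lambda>x. \<phi> (x, y)) \<in> borel_measurable borel" for y
      by (intro measurable_compose[OF _ \<phi>(1)[unfolded S_def]]) (simp add: space_PiM PiE_UNIV_domain)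
    have g1: "\<bar>g y\<bar> \<le> 1" for y
      unfolding g_def by (rule abs_integral_le_prob_algebra[OF \<nu> sec \<phi>(2)])
    have gS: "(\<lambda>z. g (snd z)) \<in> borel_measurable S"
      unfolding S_def by (rule measurable_compose[OF measurable_snd g])
    \<comment> \<open>The equality of the environment marginals enters here.\<close>
    have g_eq: "(\<integral>z. g (snd z) \<partial>\<mu>) = (\<integral>z. g (snd z) \<partial>\<mu>')"
    proof -
      have "(\<integral>z. g (snd z) \<partial>\<kappa>) = (\<integral>y. g y \<partial>distr \<kappa> (envM TYPE('y)) snd)"
        if "\<kappa> \<in> space (prob_algebra S)" for \<kappa>
      proof -
        have s: "sets \<kappa> = sets (stateM TYPE('x) TYPE('y))"
          using that by (simp add: space_prob_algebra S_def)
        have "snd \<in> \<kappa> \<rightarrow>\<^sub>M envM TYPE('y)"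
          unfolding measurable_cong_sets[OF s refl] by (rule measurable_snd)
        then show ?thesis by (rule integral_distr[OF _ g, symmetric])
      qed
      then show ?thesis using \<mu> \<mu>' marg by simp
    qed
    define k where "k z = (\<integral>w. \<phi> w \<partial>step_kernel Q z)" for z
    have k: "k \<in> borel_measurable S"
      unfolding k_def by (rule measurable_integral_kernel[OF K \<phi>(1)])
    have k1: "\<bar>k z\<bar> \<le> 1" for z
      unfolding k_def using measurable_space[OF K] sp
      by (intro abs_integral_le_prob_algebra[OF _ \<phi>]) auto
    define h where "h z = k z - a * g (snd z)" for z
    have h_good: "\<bar>h z\<bar> \<le> 1 - a" if "z \<notin> Bad" for z
      unfolding h_def k_def g_def integral_step_kernel[OF Q \<phi>(1)[unfolded S_def]]
      using that minor
      by (intro minorized_integral_diff_le[OF param_kernel_in_prob_algebra[OF Q] \<nu> a(1)] sec \<phi>(2))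
        (auto simp: Bad_def)
    have h_le: "\<bar>h z\<bar> \<le> 1 + a" for z
    proof -
      have "\<bar>a * g (snd z)\<bar> \<le> a" using g1[of "snd z"] a by (simp add: abs_mult mult_left_le)
      then show ?thesis unfolding h_def using k1[of z] by linarith
    qed
    have hm: "h \<in> borel_measurable S"
      unfolding h_def by (intro borel_measurable_diff k borel_measurable_times borel_measurable_const gS)
    \<comment> \<open>Truncating \<open>h\<close> at the level valid off \<open>Bad\<close> gives a
      function to which the factor \<open>1 - a\<close> applies everywhere. The remainder
      \<open>h2\<close> vanishes off \<open>Bad\<close> and is at most
      \<open>(1 + a) - (1 - a) = 2 * a\<close> on it.\<close>
    define h1 where "h1 z = max (a - 1) (min (1 - a) (h z))" for z
    have h1m: "h1 \<in> borel_measurable S"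
      unfolding h1_def by (intro borel_measurable_max borel_measurable_min borel_measurable_const hm)
    have h1: "\<bar>h1 z\<bar> \<le> 1 - a" for z unfolding h1_def using a by auto
    define h2 where "h2 z = h z - h1 z" for z
    have h2: "\<bar>h2 z\<bar> \<le> 2 * a * indicator Bad z" for z
    proof (cases "z \<in> Bad")
      case True
      then show ?thesis using h_le[of z] a unfolding h2_def h1_def by (auto simp: max_def min_def abs_le_iff)
    next
      case False
      then show ?thesis using h_good[of z] a unfolding h2_def h1_def by (auto simp: max_def min_def abs_le_iff)
    qed
    have h2m: "h2 \<in> borel_measurable S"
      unfolding h2_def by (rule borel_measurable_diff[OF hm h1m])
    have h2': "\<bar>h2 z\<bar> \<le> 2 * a" for z
      using h2[of z] a by (cases "z \<in> Bad") auto
    have split: "(\<integral>z. k z \<partial>\<kappa>) = a * (\<integral>z. g (snd z) \<partial>\<kappa>) + (\<integral>z. h1 z \<partial>\<kappa>) + (\<integral>z. h2 z \<partial>\<kappa>)"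
      and bad: "\<bar>\<integral>z. h2 z \<partial>\<kappa>\<bar> \<le> 2 * a * measure \<kappa> Bad"
      if \<kappa>: "\<kappa> \<in> space (prob_algebra S)" for \<kappa>
    proof -
      interpret prob_space \<kappa> using \<kappa> by (simp add: space_prob_algebra)
      have s: "sets \<kappa> = sets S" using \<kappa> by (simp add: space_prob_algebra)
      have spk: "space \<kappa> = UNIV" using sets_eq_imp_space_eq[OF s] sp by simp
      have i: "integrable \<kappa> (\<lambda>z. g (snd z))" "integrable \<kappa> h1" "integrable \<kappa> h2"
        by (rule integrable_bounded_prob_algebra[OF \<kappa> gS g1] integrable_bounded_prob_algebra[OF \<kappa> h1m h1]
            integrable_bounded_prob_algebra[OF \<kappa> h2m h2'])+
      have "k z = a * g (snd z) + h1 z + h2 z" for z unfolding h2_def h_def by simp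
      then show "(\<integral>z. k z \<partial>\<kappa>) = a * (\<integral>z. g (snd z) \<partial>\<kappa>) + (\<integral>z. h1 z \<partial>\<kappa>) + (\<integral>z. h2 z \<partial>\<kappa>)"
        using i by simp
      have "\<bar>\<integral>z. h2 z \<partial>\<kappa>\<bar> \<le> (\<integral>z. \<bar>h2 z\<bar> \<partial>\<kappa>)" by (rule integral_abs_bound)
      also have "\<dots> \<le> (\<integral>z. 2 * a * indicator Bad z \<partial>\<kappa>)"
        using i(3) h2 Bad s by (intro integral_mono)
          (auto intro!: integrable_mult_right simp: integrable_indicator_iff emeasure_eq_measure)
      also have "\<dots> = 2 * a * measure \<kappa> Bad" by (simp add: spk)
      finally show "\<bar>\<integral>z. h2 z \<partial>\<kappa>\<bar> \<le> 2 * a * measure \<kappa> Bad" .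
    qed
    have "\<bar>(\<integral>z. h1 z \<partial>\<mu>) - (\<integral>z. h1 z \<partial>\<mu>')\<bar> \<le> (1 - a) * tv_dist \<mu> \<mu>'"
      by (rule tv_dist_ge_scaled[OF \<mu> \<mu>' h1m h1])
    then show "\<bar>(\<integral>z. \<phi> z \<partial>(\<mu> \<bind> step_kernel Q)) - (\<integral>z. \<phi> z \<partial>(\<mu>' \<bind> step_kernel Q))\<bar>
        \<le> (1 - a) * tv_dist \<mu> \<mu>' + 2 * a * (measure \<mu> Bad + measure \<mu>' Bad)"
      unfolding integral_bind_prob_algebra[OF \<mu> K \<phi>] integral_bind_prob_algebra[OF \<mu>' K \<phi>]
        k_def[symmetric] split[OF \<mu>] split[OF \<mu>'] g_eq
      using bad[OF \<mu>] bad[OF \<mu>'] by (simp add: distrib_left)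
  qed
qed

text \<open>The one-step estimate is an affine recursion with slope \<open>1 - a\<close> and
  increment \<open>2 * a * (b + b')\<close>. The value \<open>2 * (b + b')\<close> is preserved by
  it, and the initial distance is at most 2. The bounds \<open>b\<close> and \<open>b'\<close> must
  hold at all times.\<close>

lemma tv_dist_iterates_le:
  fixes Q :: "'x::topological_space \<Rightarrow> 'y::topological_space \<Rightarrow> 'x measure"
  defines "S \<equiv> stateM TYPE('x) TYPE('y)"
  assumes Q: "param_kernel Q"
    and m: "\<And>t::nat. m t \<in> space (prob_algebra S)" "\<And>t. m (Suc t) = m t \<bind> step_kernel Q"
    and m': "\<And>t. m' t \<in> space (prob_algebra S)" "\<And>t. m' (Suc t) = m' t \<bind> step_kernel Q"
    and marg: "\<And>t. distr (m t) (envM TYPE('y)) snd = distr (m' t) (envM TYPE('y)) snd"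
    and C: "C \<in> sets borel" and D: "D \<in> sets borel"
    and a: "0 \<le> a" "a \<le> 1" and \<nu>: "\<nu> \<in> space (prob_algebra borel)"
    and minor: "\<And>x y A. x \<in> C \<Longrightarrow> y \<in> D \<Longrightarrow> A \<in> sets borel \<Longrightarrow> a * measure \<nu> A \<le> measure (Q x y) A"
    and b: "\<And>t. measure (m t) {z. fst z \<notin> C \<or> snd z 0 \<notin> D} \<le> b"
    and b': "\<And>t. measure (m' t) {z. fst z \<notin> C \<or> snd z 0 \<notin> D} \<le> b'"
  shows "tv_dist (m t) (m' t) \<le> 2 * (1 - a) ^ t + 2 * (b + b')"
proof (induction t)
  case 0
  have "0 \<le> b" "0 \<le> b'" using b[of 0] b'[of 0] measure_nonneg order_trans by blast+
  then show ?case using tv_dist_le_2[OF m(1) m'(1), of 0 0] by simp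
next
  case (Suc t)
  have "tv_dist (m (Suc t)) (m' (Suc t)) \<le> (1 - a) * tv_dist (m t) (m' t)
    + 2 * a * (measure (m t) {z. fst z \<notin> C \<or> snd z 0 \<notin> D} + measure (m' t) {z. fst z \<notin> C \<or> snd z 0 \<notin> D})"
    unfolding m(2) m'(2)
    by (rule tv_dist_step_kernel_le[OF Q m(1)[unfolded S_def] m'(1)[unfolded S_def] marg C D a \<nu> minor])
  also have "\<dots> \<le> (1 - a) * (2 * (1 - a) ^ t + 2 * (b + b')) + 2 * a * (b + b')"
    using a b b' Suc by (intro add_mono mult_left_mono) auto
  also have "\<dots> = 2 * (1 - a) ^ Suc t + 2 * (b + b')" by (simp add: algebra_simps)
  finally show ?case .
qed

section \<open>Laws of the chain\<close>

text \<open>The reindexing \<open>f\<close> and the measure \<open>N\<close> are left free, so that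
  the lemma covers time shifts both over \<open>M\<close> and over the sigma-algebras of
  \<open>filt\<close>.\<close>

lemma measurable_env_path:
  fixes Y :: "int \<Rightarrow> 'a \<Rightarrow> 'y::topological_space"
  assumes "\<And>j. Y j \<in> N \<rightarrow>\<^sub>M borel"
  shows "(\<lambda>\<omega> k. Y (f k) \<omega>) \<in> N \<rightarrow>\<^sub>M envM TYPE('y)"
proof (rule measurable_PiM_single')
  show "Y (f k) \<in> N \<rightarrow>\<^sub>M borel" for k by (rule assms)
qed (simp add: PiE_UNIV_domain)

lemma mcreD:
  assumes "mcre M X Y Q"
  shows "X t \<in> M \<rightarrow>\<^sub>M borel" "Y j \<in> M \<rightarrow>\<^sub>M borel"
    and "A \<in> sets borel \<Longrightarrow> AE \<omega> in M. real_cond_exp M (filt M X Y t)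
      (indicator {\<omega>'\<in>space M. X (Suc t) \<omega>' \<in> A}) \<omega> = measure (Q (X t \<omega>) (Y (int t) \<omega>)) A"
  using assms unfolding mcre_def by blast+

lemma space_filt: "space (filt M X Y t) = space M"
  unfolding filt_def by (rule space_measure_of) auto

text \<open>The whole environment, past and future, is contained in each
  \<open>filt M X Y t\<close>, so \<open>j\<close> and \<open>t\<close> are unrelated.\<close>

lemma measurable_filt_env: "Y j \<in> filt M X Y t \<rightarrow>\<^sub>M borel"
proof (rule measurableI)
  fix B assume "B \<in> sets (borel :: 'b measure)"
  then show "Y j -` B \<inter> space (filt M X Y t) \<in> sets (filt M X Y t)"
    unfolding space_filt unfolding filt_def by (subst sets_measure_of) auto
qed simp

lemma subalgebra_filt:
  assumes "\<And>t. X t \<in> M \<rightarrow>\<^sub>M borel" "\<And>j. Y j \<in> M \<rightarrow>\<^sub>M borel"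
  shows "subalgebra M (filt M X Y t)"
  unfolding subalgebra_def
proof
  show "sets (filt M X Y t) \<subseteq> sets M"
  proof -
    let ?G = "(\<Union>j. {Y j -` B \<inter> space M | B. B \<in> sets borel}) \<union>
      (\<Union>j\<in>{..t}. {X j -` B \<inter> space M | B. B \<in> sets borel})"
    have "?G \<subseteq> sets M"
      using measurable_sets[OF assms(1)] measurable_sets[OF assms(2)] by blast
    then have "sigma_sets (space M) ?G \<subseteq> sets M" by (rule sets.sigma_sets_subset)
    moreover have "sets (filt M X Y t) = sigma_sets (space M) ?G"
      unfolding filt_def by (rule sets_measure_of) auto
    ultimately show ?thesis by simp
  qed
qed (rule space_filt)

lemma measurable_state:
  fixes X :: "nat \<Rightarrow> 'a \<Rightarrow> 'x::topological_space" and Y :: "int \<Rightarrow> 'a \<Rightarrow> 'y::topological_space"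
  assumes "\<And>t. X t \<in> M \<rightarrow>\<^sub>M borel" "\<And>j. Y j \<in> M \<rightarrow>\<^sub>M borel"
  shows "(\<lambda>\<omega>. (X t \<omega>, \<lambda>k. Y (int t + k) \<omega>)) \<in> M \<rightarrow>\<^sub>M stateM TYPE('x) TYPE('y)"
  by (intro measurable_Pair assms measurable_env_path)

lemma law_at_in_prob_algebra:
  fixes X :: "nat \<Rightarrow> 'a \<Rightarrow> 'x::topological_space" and Y :: "int \<Rightarrow> 'a \<Rightarrow> 'y::topological_space"
  assumes "prob_space M" "mcre M X Y Q"
  shows "law_at M X Y t \<in> space (prob_algebra (stateM TYPE('x) TYPE('y)))"
  unfolding law_at_def space_prob_algebra
  using prob_space.prob_space_distr[OF assms(1) measurable_state[OF mcreD(1,2)[OF assms(2)]]] by simp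

text \<open>The environment moves deterministically, so on rectangles the kernel splits into an
  indicator of the shifted path and a value of \<open>Q\<close>.\<close>

lemma emeasure_step_kernel_Times:
  fixes Q :: "'x::topological_space \<Rightarrow> 'y::topological_space \<Rightarrow> 'x measure"
  assumes Q: "param_kernel Q" and A: "A \<in> sets borel" and B: "B \<in> sets (envM TYPE('y))"
  shows "emeasure (step_kernel Q z) (A \<times> B)
    = ennreal (indicator B (\<lambda>k. snd z (k + 1)) * measure (Q (fst z) (snd z 0)) A)"
proof -
  have p: "prob_space (Q (fst z) (snd z 0))" and s: "sets (Q (fst z) (snd z 0)) = sets borel"
    using Q unfolding param_kernel_def by blast+
  have sp: "space (Q (fst z) (snd z 0)) = UNIV" using sets_eq_imp_space_eq[OF s] by simp
  have meas: "(\<lambda>x. (x, \<lambda>k. snd z (k + 1))) \<in> Q (fst z) (snd z 0) \<rightarrow>\<^sub>M stateM TYPE('x) TYPE('y)"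
    unfolding measurable_cong_sets[OF s refl]
    by (intro measurable_Pair measurable_ident measurable_const) (simp_all add: space_PiM PiE_UNIV_domain)
  have "emeasure (step_kernel Q z) (A \<times> B)
      = emeasure (Q (fst z) (snd z 0)) ((\<lambda>x. (x, \<lambda>k. snd z (k + 1))) -` (A \<times> B) \<inter> UNIV)"
    unfolding step_kernel_def emeasure_distr[OF meas pair_measureI[OF A B]] sp ..
  also have "(\<lambda>x. (x, \<lambda>k. snd z (k + 1))) -` (A \<times> B) \<inter> UNIV = (if (\<lambda>k. snd z (k + 1)) \<in> B then A else {})"
    by auto
  finally show ?thesis
    by (simp add: finite_measure.emeasure_eq_measure[OF prob_space.finite_measure[OF p]])
qed

text \<open>Both sides are finite measures, so it suffices to compare them on measurable rectangles.
  There the environment event is known given \<open>filt M X Y t\<close>, and the Markov property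
  evaluates the conditional probability of the next state.\<close>

lemma law_at_Suc:
  fixes X :: "nat \<Rightarrow> 'a \<Rightarrow> 'x::topological_space" and Y :: "int \<Rightarrow> 'a \<Rightarrow> 'y::topological_space"
  assumes M: "prob_space M" and Q: "param_kernel Q" and ch: "mcre M X Y Q"
  shows "law_at M X Y (Suc t) = law_at M X Y t \<bind> step_kernel Q"
proof (rule measure_eqI_generator_eq[where E="{a \<times> b | a b. a \<in> sets borel \<and> b \<in> sets (envM TYPE('y))}"
      and A="\<lambda>_. UNIV" and \<Omega>="space borel \<times> space (envM TYPE('y))"])
  interpret prob_space M by fact
  note X = mcreD(1)[OF ch] and Y = mcreD(2)[OF ch]
  interpret finite_measure_subalgebra M "filt M X Y t"
    by unfold_locales (rule subalgebra_filt[OF X Y])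
  have K: "step_kernel Q \<in> stateM TYPE('x) TYPE('y) \<rightarrow>\<^sub>M prob_algebra (stateM TYPE('x) TYPE('y))"
    by (rule measurable_step_kernel[OF Q])
  note law = law_at_in_prob_algebra[OF M ch]
  show "Int_stable {a \<times> b | a b. a \<in> sets borel \<and> b \<in> sets (envM TYPE('y))}"
    by (rule Int_stable_pair_measure_generator)
  show "{a \<times> b | a b. a \<in> sets borel \<and> b \<in> sets (envM TYPE('y))} \<subseteq> Pow (space borel \<times> space (envM TYPE('y)))"
    by (rule pair_measure_closed)
  show "sets (law_at M X Y (Suc t)) = sigma_sets (space borel \<times> space (envM TYPE('y)))
      {a \<times> b | a b. a \<in> sets borel \<and> b \<in> sets (envM TYPE('y))}"
    unfolding law_at_def by (simp add: sets_pair_measure)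
  show "sets (law_at M X Y t \<bind> step_kernel Q) = sigma_sets (space borel \<times> space (envM TYPE('y)))
      {a \<times> b | a b. a \<in> sets borel \<and> b \<in> sets (envM TYPE('y))}"
    using sets_bind'[OF law K, of t] by (simp only: sets_pair_measure)
  have "UNIV \<in> sets (envM TYPE('y))"
    using sets.top[of "envM TYPE('y)"] by (simp only: space_envM)
  then have "\<exists>a b. (UNIV :: ('x \<times> (int \<Rightarrow> 'y)) set) = a \<times> b \<and> a \<in> sets borel \<and> b \<in> sets (envM TYPE('y))"
    by (intro exI[of _ UNIV] conjI) (rule UNIV_Times_UNIV[symmetric] borel_open open_UNIV | assumption)+
  then show "range (\<lambda>_. UNIV) \<subseteq> {a \<times> b | a b. a \<in> sets (borel::'x measure) \<and> b \<in> sets (envM TYPE('y))}"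
    by (intro image_subsetI CollectI)
  show "(\<Union>i::nat. UNIV) = space (borel::'x measure) \<times> space (envM TYPE('y))"
    by (simp add: space_envM)
  show "emeasure (law_at M X Y (Suc t)) UNIV \<noteq> \<infinity>"
    using finite_measure.emeasure_finite[OF prob_space.finite_measure, of "law_at M X Y (Suc t)"] law[of "Suc t"]
    by (simp add: space_prob_algebra)
  fix Z assume "Z \<in> {a \<times> b | a b. a \<in> sets (borel::'x measure) \<and> b \<in> sets (envM TYPE('y))}"
  then obtain A :: "'x set" and B where Z: "Z = A \<times> B" and A: "A \<in> sets borel" and B: "B \<in> sets (envM TYPE('y))"
    by blast
  \<comment> \<open>The environment event seen from time \<open>t + 1\<close>. The index is written
    \<open>int t + (k + 1)\<close> to match the shift in \<open>step_kernel\<close>.\<close>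
  define G where "G = (\<lambda>\<omega> k. Y (int t + (k + 1)) \<omega>) -` B \<inter> space M"
  have GF: "G \<in> sets (filt M X Y t)"
    using measurable_sets[OF measurable_env_path[of Y "filt M X Y t" "\<lambda>k. int t + (k + 1)", OF measurable_filt_env] B]
    unfolding G_def space_filt .
  have G: "G \<in> sets M" using GF subalg unfolding subalgebra_def by blast
  define H where "H = {\<omega> \<in> space M. X (Suc t) \<omega> \<in> A}"
  have H: "H \<in> sets M" using measurable_sets[OF X A] unfolding H_def by (simp add: vimage_def Int_def conj_commute)
  let ?q = "\<lambda>\<omega>. measure (Q (X t \<omega>) (Y (int t) \<omega>)) A"
  have st: "(\<lambda>\<omega>. (X t \<omega>, \<lambda>k. Y (int t + k) \<omega>)) \<in> M \<rightarrow>\<^sub>M stateM TYPE('x) TYPE('y)" for t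
    by (rule measurable_state[OF X Y])
  have q: "?q \<in> borel_measurable M"
    using measurable_compose[OF st measurable_compose[OF measurable_prob_algebraD[OF measurable_param_kernel[OF Q]]
        measurable_measure_subprob_algebra[OF A]], of t]
    by (simp only: fst_conv snd_conv add_0_right)
  have q1: "?q \<omega> \<le> 1" for \<omega>
    using param_kernel_in_prob_algebra[OF Q] by (simp add: space_prob_algebra prob_space.prob_le_1)
  have Gq: "(\<lambda>\<omega>. indicator G \<omega> * ?q \<omega>) \<in> borel_measurable M"
    using G q by (intro borel_measurable_times borel_measurable_indicator)
  have AB: "A \<times> B \<in> sets (stateM TYPE('x) TYPE('y))" by (rule pair_measureI[OF A B])
  have "emeasure (law_at M X Y (Suc t)) Z = emeasure M ((\<lambda>\<omega>. (X (Suc t) \<omega>, \<lambda>k. Y (int (Suc t) + k) \<omega>)) -` (A \<times> B) \<inter> space M)"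
    unfolding law_at_def Z by (rule emeasure_distr[OF st AB])
  also have "(\<lambda>\<omega>. (X (Suc t) \<omega>, \<lambda>k. Y (int (Suc t) + k) \<omega>)) -` (A \<times> B) \<inter> space M = G \<inter> H"
    unfolding G_def H_def by (auto simp: add_ac)
  also have "emeasure M (G \<inter> H) = ennreal (\<integral>\<omega>. indicator G \<omega> * indicator H \<omega> \<partial>M)"
    using G H sets.sets_into_space[OF G] by (simp add: emeasure_eq_measure indicator_inter_arith[symmetric] Int_absorb2 inf.absorb1 le_infI1)
  \<comment> \<open>The defining property of conditional expectation, available because
    \<open>G\<close> belongs to \<open>filt M X Y t\<close>.\<close>
  also have "(\<integral>\<omega>. indicator G \<omega> * indicator H \<omega> \<partial>M)
      = (\<integral>\<omega>. indicator G \<omega> * real_cond_exp M (filt M X Y t) (indicator H) \<omega> \<partial>M)"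
    using G H GF by (intro real_cond_exp_intg(2)[symmetric])
      (auto simp: indicator_inter_arith[symmetric] integrable_indicator_iff emeasure_eq_measure)
  also have "\<dots> = (\<integral>\<omega>. indicator G \<omega> * ?q \<omega> \<partial>M)"
  proof (rule integral_cong_AE)
    have "real_cond_exp M (filt M X Y t) (indicator H) \<in> borel_measurable M"
      by (rule borel_measurable_cond_exp2)
    then show "(\<lambda>\<omega>. indicator G \<omega> * real_cond_exp M (filt M X Y t) (indicator H) \<omega>) \<in> borel_measurable M"
      using G by (intro borel_measurable_times borel_measurable_indicator)
    show "AE \<omega> in M. indicator G \<omega> * real_cond_exp M (filt M X Y t) (indicator H) \<omega> = indicator G \<omega> * ?q \<omega>"
      using mcreD(3)[OF ch A, of t] unfolding H_def[symmetric] by eventually_elim simp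
  qed (rule Gq)
  also have "ennreal \<dots> = (\<integral>\<^sup>+\<omega>. ennreal (indicator G \<omega> * ?q \<omega>) \<partial>M)"
  proof (rule nn_integral_eq_integral[symmetric])
    show "integrable M (\<lambda>\<omega>. indicator G \<omega> * ?q \<omega>)"
      using q1 by (intro integrable_const_bound[where B=1] AE_I2 Gq) (auto simp: indicator_def)
  qed (auto simp: indicator_def)
  \<comment> \<open>On the sample space, lying in \<open>G\<close> means that the shifted path lies
    in \<open>B\<close>, so the integrand is the rectangle formula of the kernel.\<close>
  also have "\<dots> = (\<integral>\<^sup>+\<omega>. emeasure (step_kernel Q (X t \<omega>, \<lambda>k. Y (int t + k) \<omega>)) (A \<times> B) \<partial>M)"
    unfolding emeasure_step_kernel_Times[OF Q A B]
    by (intro nn_integral_cong) (simp add: G_def indicator_def)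
  also have "\<dots> = (\<integral>\<^sup>+z. emeasure (step_kernel Q z) (A \<times> B) \<partial>law_at M X Y t)"
    unfolding law_at_def
    by (rule nn_integral_distr[OF st, symmetric], unfold measurable_distr_eq1)
      (rule measurable_compose[OF measurable_prob_algebraD[OF K] measurable_emeasure_subprob_algebra[OF AB]])
  also have "\<dots> = emeasure (law_at M X Y t \<bind> step_kernel Q) Z"
    unfolding Z by (rule emeasure_bind_prob_algebra[OF law K AB, symmetric])
  finally show "emeasure (law_at M X Y (Suc t)) Z = emeasure (law_at M X Y t \<bind> step_kernel Q) Z" .
qed

section \<open>Environment marginals and escaping mass under stationarity\<close>

text \<open>Stationarity removes the dependence on \<open>t\<close>, so the laws of any two chains,
  even at different times, share the marginal needed for the one-step contraction.\<close>

lemma distr_snd_law_at: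
  fixes X :: "nat \<Rightarrow> 'a \<Rightarrow> 'x::topological_space" and Y :: "int \<Rightarrow> 'a \<Rightarrow> 'y::topological_space"
  assumes ch: "mcre M X Y Q" and stat: "strictly_stationary M Y"
  shows "distr (law_at M X Y t) (envM TYPE('y)) snd = env_law M Y"
proof -
  have "distr (law_at M X Y t) (envM TYPE('y)) snd = distr M (envM TYPE('y)) (\<lambda>\<omega> k. Y (int t + k) \<omega>)"
    unfolding law_at_def
    by (subst distr_distr[OF measurable_snd measurable_state[OF mcreD(1,2)[OF ch]]]) (simp add: comp_def)
  also have "\<dots> = env_law M Y"
    using stat unfolding strictly_stationary_def add.commute[of "int t"] by blast
  finally show ?thesis .
qed

text \<open>Stationarity concerns laws of whole paths, so the event is read as a cylinder over
  coordinate 0 and pulled back along the shift by \<open>s\<close>.\<close>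

lemma measure_env_stationary:
  fixes Y :: "int \<Rightarrow> 'a \<Rightarrow> 'y::topological_space"
  assumes Y: "\<And>j. Y j \<in> M \<rightarrow>\<^sub>M borel" and stat: "strictly_stationary M Y" and D: "D \<in> sets borel"
  shows "measure M {\<omega>\<in>space M. Y s \<omega> \<notin> D} = measure M {\<omega>\<in>space M. Y 0 \<omega> \<notin> D}"
proof -
  let ?E = "(\<lambda>y. y 0) -` (- D) \<inter> space (envM TYPE('y))"
  have "(\<lambda>y. y 0) \<in> envM TYPE('y) \<rightarrow>\<^sub>M borel" by measurable
  then have E: "?E \<in> sets (envM TYPE('y))" by (rule measurable_sets) (use D in auto)
  have *: "measure (distr M (envM TYPE('y)) (\<lambda>\<omega> k. Y (k + s) \<omega>)) ?E = measure M {\<omega>\<in>space M. Y s \<omega> \<notin> D}" for s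
    by (subst measure_distr[OF measurable_env_path[OF Y] E])
      (auto simp: space_PiM PiE_UNIV_domain intro!: arg_cong[where f="measure M"])
  show ?thesis
    using *[of s] *[of 0] stat unfolding strictly_stationary_def env_law_def by simp
qed

lemma measurable_notin:
  assumes "f \<in> M \<rightarrow>\<^sub>M N" "C \<in> sets N"
  shows "{\<omega>\<in>space M. f \<omega> \<notin> C} \<in> sets M"
proof -
  have "{\<omega>\<in>space M. f \<omega> \<notin> C} = space M - (f -` C \<inter> space M)" by blast
  then show ?thesis using measurable_sets[OF assms] by (simp only: sets.compl_sets)
qed

text \<open>A union bound made free of \<open>t\<close>: the supremum absorbs the time in the chain
  part, stationarity in the environment part.\<close>

lemma measure_law_at_bad_le:
  fixes X :: "nat \<Rightarrow> 'a \<Rightarrow> 'x::topological_space" and Y :: "int \<Rightarrow> 'a \<Rightarrow> 'y::topological_space"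
  assumes M: "prob_space M" and ch: "mcre M X Y Q" and stat: "strictly_stationary M Y"
    and C: "C \<in> sets borel" and D: "D \<in> sets borel"
  shows "measure (law_at M X Y t) {z. fst z \<notin> C \<or> snd z 0 \<notin> D}
    \<le> (SUP t. measure M {\<omega>\<in>space M. X t \<omega> \<notin> C}) + measure M {\<omega>\<in>space M. Y 0 \<omega> \<notin> D}"
proof -
  interpret prob_space M by fact
  note X = mcreD(1)[OF ch] and Y = mcreD(2)[OF ch]
  have "{z \<in> space (stateM TYPE('x) TYPE('y)). fst z \<notin> C \<or> snd z 0 \<notin> D} \<in> sets (stateM TYPE('x) TYPE('y))"
    using C D by measurable
  then have "{z. fst z \<notin> C \<or> snd z 0 \<notin> D} \<in> sets (stateM TYPE('x) TYPE('y))"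
    by (simp only: space_stateM UNIV_I simp_thms)
  then have "measure (law_at M X Y t) {z. fst z \<notin> C \<or> snd z 0 \<notin> D}
      = measure M ((\<lambda>\<omega>. (X t \<omega>, \<lambda>k. Y (int t + k) \<omega>)) -` {z. fst z \<notin> C \<or> snd z 0 \<notin> D} \<inter> space M)"
    unfolding law_at_def by (rule measure_distr[OF measurable_state[OF X Y]])
  also have "(\<lambda>\<omega>. (X t \<omega>, \<lambda>k. Y (int t + k) \<omega>)) -` {z. fst z \<notin> C \<or> snd z 0 \<notin> D} \<inter> space M
      = {\<omega>\<in>space M. X t \<omega> \<notin> C} \<union> {\<omega>\<in>space M. Y (int t) \<omega> \<notin> D}" by auto
  also have "measure M \<dots> \<le> measure M {\<omega>\<in>space M. X t \<omega> \<notin> C} + measure M {\<omega>\<in>space M. Y (int t) \<omega> \<notin> D}"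
  proof (rule measure_Un_le)
    show "{\<omega>\<in>space M. X t \<omega> \<notin> C} \<in> sets M"
      by (rule measurable_notin[OF X C])
    show "{\<omega>\<in>space M. Y (int t) \<omega> \<notin> D} \<in> sets M"
      by (rule measurable_notin[OF Y D])
  qed
  also have "\<dots> \<le> (SUP t. measure M {\<omega>\<in>space M. X t \<omega> \<notin> C}) + measure M {\<omega>\<in>space M. Y 0 \<omega> \<notin> D}"
    unfolding measure_env_stationary[OF Y stat D, where s="int t"]
    by (intro add_right_mono cSUP_upper bdd_aboveI2[where M=1]) (auto simp: prob_le_1)
  finally show ?thesis .
qed

section \<open>Convergence, merging and invariance\<close>

text \<open>The order of choice matters: first \<open>n\<close> makes the escaping mass small, then
  \<open>T\<close> is chosen for the rate \<open>1 - a n\<close> of that fixed \<open>n\<close>.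
  Nothing prevents these rates from approaching 1 as \<open>n\<close> grows.\<close>

lemma eventually_uniform_geometric_bound:
  fixes a \<eta> :: "nat \<Rightarrow> real" and e :: real
  assumes a: "\<And>n. 0 < a n" "\<And>n. a n \<le> 1" and \<eta>: "\<eta> \<longlonglongrightarrow> 0" and e: "0 < e"
  shows "\<exists>n T. \<forall>t\<ge>T. 2 * (1 - a n) ^ t + 2 * \<eta> n \<le> e"
proof -
  have "\<forall>\<^sub>F n in sequentially. \<eta> n < e / 4"
    using \<eta> e by (intro order_tendstoD) auto
  then obtain n where n: "\<eta> n < e / 4" by (auto simp: eventually_sequentially)
  have "(\<lambda>t. (1 - a n) ^ t) \<longlonglongrightarrow> 0"
    using a[of n] by (intro LIMSEQ_realpow_zero) auto
  then have "\<forall>\<^sub>F t in sequentially. (1 - a n) ^ t < e / 4"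
    using e by (intro order_tendstoD) auto
  then obtain T where T: "\<And>t. t \<ge> T \<Longrightarrow> (1 - a n) ^ t < e / 4" by (auto simp: eventually_sequentially)
  show ?thesis
  proof (intro exI allI impI)
    fix t assume "T \<le> t"
    then show "2 * (1 - a n) ^ t + 2 * \<eta> n \<le> e" using T[of t] n by linarith
  qed
qed

theorem mainTheorem4:
  fixes M :: "'a measure"
    and X :: "nat \<Rightarrow> 'a \<Rightarrow> 'x::polish_space"
    and Y :: "int \<Rightarrow> 'a \<Rightarrow> 'y::polish_space"
    and Q :: "'x \<Rightarrow> 'y \<Rightarrow> 'x measure"
    and Xs :: "nat \<Rightarrow> 'x set" and Ys :: "nat \<Rightarrow> 'y set"
    and \<alpha> :: "nat \<Rightarrow> real" and \<nu> :: "nat \<Rightarrow> 'x measure"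
  assumes M: "prob_space M"
    and Xs_borel: "\<And>n. Xs n \<in> sets borel" and Ys_borel: "\<And>n. Ys n \<in> sets borel"
    and Xs_mono: "incseq Xs" and Ys_mono: "incseq Ys"
    and Xs0: "Xs 0 \<noteq> {}" and Ys0: "Ys 0 \<noteq> {}"
    and Y_rv: "\<And>j. Y j \<in> M \<rightarrow>\<^sub>M borel"
    and Y_stat: "strictly_stationary M Y"
    and Q: "param_kernel Q"
    and Y_tight: "(\<lambda>n. measure M {\<omega>\<in>space M. Y 0 \<omega> \<notin> Ys n}) \<longlonglongrightarrow> 0"
    and \<alpha>_mono: "antimono \<alpha>" and \<alpha>_pos: "\<And>n. 0 < \<alpha> n" and \<alpha>_le1: "\<And>n. \<alpha> n \<le> 1"
    and \<nu>: "\<And>n. prob_space (\<nu> n) \<and> sets (\<nu> n) = sets borel"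
    and minor: "\<And>n x y A. x \<in> Xs n \<Longrightarrow> y \<in> Ys n \<Longrightarrow> A \<in> sets borel \<Longrightarrow>
                   measure (Q x y) A \<ge> \<alpha> n * measure (\<nu> n) A"
    and Mb_ne: "Mb M Y Q Xs \<noteq> {}"
    and X_chain: "mcre M X Y Q"
    and X_init: "law_at M X Y 0 \<in> Mb M Y Q Xs"
  shows "\<exists>\<mu>. prob_space \<mu> \<and> sets \<mu> = sets (stateM TYPE('x) TYPE('y)) \<and>
           (\<lambda>t. tv_dist (law_at M X Y t) \<mu>) \<longlonglongrightarrow> 0 \<and>
           (\<forall>X'. mcre M X' Y Q \<and> law_at M X' Y 0 \<in> Mb M Y Q Xs \<longrightarrow>
              (\<lambda>t. tv_dist (law_at M X Y t) (law_at M X' Y t)) \<longlonglongrightarrow> 0 \<and>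
              (\<lambda>t. tv_dist (law_at M X' Y t) \<mu>) \<longlonglongrightarrow> 0) \<and>
           (\<forall>X''. mcre M X'' Y Q \<and> law_at M X'' Y 0 = \<mu> \<longrightarrow>
              (\<forall>t. law_at M X'' Y t = \<mu>))"
proof -
  let ?S = "stateM TYPE('x) TYPE('y)"
  let ?K = "step_kernel Q"
  interpret prob_space M by fact
  have K: "?K \<in> ?S \<rightarrow>\<^sub>M prob_algebra ?S" by (rule measurable_step_kernel[OF Q])
  have \<nu>': "\<nu> n \<in> space (prob_algebra borel)" for n using \<nu> by (simp add: space_prob_algebra)
  \<comment> \<open>The time-uniform bound on the mass outside \<open>Xs n\<close> and
    \<open>Ys n\<close>; tightness of the chain handles the first summand, \<open>Y_tight\<close>
    the second.\<close>
  define \<eta> where "\<eta> V n = (SUP t. measure M {\<omega>\<in>space M. V t \<omega> \<notin> Xs n}) + measure M {\<omega>\<in>space M. Y 0 \<omega> \<notin> Ys n}"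
    for V :: "nat \<Rightarrow> 'a \<Rightarrow> 'x" and n
  have \<eta>: "\<eta> V \<longlonglongrightarrow> 0" if "mcre M V Y Q" "law_at M V Y 0 \<in> Mb M Y Q Xs" for V
  proof -
    \<comment> \<open>\<open>Mb\<close> speaks of all realizations of the chain; it is instantiated
      with \<open>M\<close>, \<open>V\<close> and \<open>Y\<close> themselves.\<close>
    have "tight_chain M V Xs" using that M unfolding Mb_def by blast
    then have "\<eta> V \<longlonglongrightarrow> 0 + 0"
      unfolding \<eta>_def tight_chain_def by (intro tendsto_add Y_tight)
    then show ?thesis by simp
  qed
  have law: "law_at M V Y t \<in> space (prob_algebra ?S)" if "mcre M V Y Q" for V t
    by (rule law_at_in_prob_algebra[OF M that])
  \<comment> \<open>The offsets \<open>r\<close> and \<open>s\<close> do not appear on the right, as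
    \<eta> is uniform in time. Equal offsets with two chains give merging; one chain with different
    offsets gives the Cauchy property.\<close>
  have bound: "tv_dist (law_at M V Y (t + r)) (law_at M W Y (t + s)) \<le> 2 * (1 - \<alpha> n) ^ t + 2 * (\<eta> V n + \<eta> W n)"
    if V: "mcre M V Y Q" and W: "mcre M W Y Q" for V W r s t n
  proof (rule tv_dist_iterates_le[where m="\<lambda>t. law_at M V Y (t + r)" and m'="\<lambda>t. law_at M W Y (t + s)", OF Q])
    show "\<nu> n \<in> space (prob_algebra borel)" by (rule \<nu>')
    show "0 \<le> \<alpha> n" "\<alpha> n \<le> 1" using \<alpha>_pos[of n] \<alpha>_le1[of n] by auto
    show "Xs n \<in> sets borel" "Ys n \<in> sets borel" by (rule Xs_borel Ys_borel)+
    show "\<alpha> n * measure (\<nu> n) A \<le> measure (Q x y) A" if "x \<in> Xs n" "y \<in> Ys n" "A \<in> sets borel" for x y A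
      by (rule minor[OF that])
    show "law_at M V Y (t + r) \<in> space (prob_algebra ?S)" "law_at M W Y (t + s) \<in> space (prob_algebra ?S)" for t
      by (rule law[OF V] law[OF W])+
    show "law_at M V Y (Suc t + r) = law_at M V Y (t + r) \<bind> ?K" "law_at M W Y (Suc t + s) = law_at M W Y (t + s) \<bind> ?K" for t
      using law_at_Suc[OF M Q V, of "t + r"] law_at_Suc[OF M Q W, of "t + s"] by simp_all
    show "distr (law_at M V Y (t + r)) (envM TYPE('y)) snd = distr (law_at M W Y (t + s)) (envM TYPE('y)) snd" for t
      by (simp only: distr_snd_law_at[OF V Y_stat] distr_snd_law_at[OF W Y_stat])
    show "measure (law_at M V Y (t + r)) {z. fst z \<notin> Xs n \<or> snd z 0 \<notin> Ys n} \<le> \<eta> V n"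
      "measure (law_at M W Y (t + s)) {z. fst z \<notin> Xs n \<or> snd z 0 \<notin> Ys n} \<le> \<eta> W n" for t
      unfolding \<eta>_def
      by (rule measure_law_at_bad_le[OF M V Y_stat Xs_borel Ys_borel]
          measure_law_at_bad_le[OF M W Y_stat Xs_borel Ys_borel])+
  qed
  have close: "\<exists>T. \<forall>t\<ge>T. \<forall>r s. tv_dist (law_at M V Y (t + r)) (law_at M W Y (t + s)) \<le> e"
    if V: "mcre M V Y Q" "law_at M V Y 0 \<in> Mb M Y Q Xs"
      and W: "mcre M W Y Q" "law_at M W Y 0 \<in> Mb M Y Q Xs" and e: "0 < e" for V W e
  proof -
    have "(\<lambda>n. \<eta> V n + \<eta> W n) \<longlonglongrightarrow> 0" using tendsto_add[OF \<eta>[OF V] \<eta>[OF W]] by simp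
    from eventually_uniform_geometric_bound[where a=\<alpha>, OF \<alpha>_pos \<alpha>_le1 this e]
    obtain n T where "\<And>t. t \<ge> T \<Longrightarrow> 2 * (1 - \<alpha> n) ^ t + 2 * (\<eta> V n + \<eta> W n) \<le> e" by blast
    then have "\<And>t r s. t \<ge> T \<Longrightarrow> tv_dist (law_at M V Y (t + r)) (law_at M W Y (t + s)) \<le> e"
      using bound[OF V(1) W(1)] order_trans by blast
    then show ?thesis by blast
  qed
  have "\<exists>T. \<forall>s\<ge>T. \<forall>t\<ge>T. tv_dist (law_at M X Y s) (law_at M X Y t) \<le> e" if e: "0 < e" for e
  proof -
    \<comment> \<open>Times \<open>s\<close> and \<open>t\<close> beyond \<open>T\<close> are
      reached by \<open>T\<close> contraction steps from the laws at times \<open>s - T\<close> and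
      \<open>t - T\<close>.\<close>
    obtain T where T: "\<And>r s. tv_dist (law_at M X Y (T + r)) (law_at M X Y (T + s)) \<le> e"
      using close[OF X_chain X_init X_chain X_init e] by blast
    show ?thesis
    proof (intro exI allI impI)
      fix s t assume "T \<le> s" "T \<le> t"
      then show "tv_dist (law_at M X Y s) (law_at M X Y t) \<le> e"
        using T[of "s - T" "t - T"] by simp
    qed
  qed
  from tv_dist_complete[OF law[OF X_chain] this]
  obtain \<mu> where \<mu>: "\<mu> \<in> space (prob_algebra ?S)" and lim: "(\<lambda>t. tv_dist (law_at M X Y t) \<mu>) \<longlonglongrightarrow> 0"
    by blast
  have XX': "(\<lambda>t. tv_dist (law_at M X Y t) (law_at M X' Y t)) \<longlonglongrightarrow> 0"
    and X'\<mu>: "(\<lambda>t. tv_dist (law_at M X' Y t) \<mu>) \<longlonglongrightarrow> 0"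
    if X': "mcre M X' Y Q" "law_at M X' Y 0 \<in> Mb M Y Q Xs" for X'
  proof -
    show *: "(\<lambda>t. tv_dist (law_at M X Y t) (law_at M X' Y t)) \<longlonglongrightarrow> 0"
    proof (rule LIMSEQ_I)
      fix e :: real assume e: "0 < e"
      then have "0 < e / 2" by simp
      from close[OF X_chain X_init X' this]
      obtain T where T: "\<And>t r s. t \<ge> T \<Longrightarrow> tv_dist (law_at M X Y (t + r)) (law_at M X' Y (t + s)) \<le> e / 2" by blast
      have "norm (tv_dist (law_at M X Y t) (law_at M X' Y t) - 0) < e" if "t \<ge> T" for t
        using T[OF that, of 0 0] tv_dist_nonneg[OF law[OF X_chain] law[OF X'(1)], of t t] e by simp
      then show "\<exists>T. \<forall>t\<ge>T. norm (tv_dist (law_at M X Y t) (law_at M X' Y t) - 0) < e" by blast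
    qed
    have "(\<lambda>t. tv_dist (law_at M X Y t) (law_at M X' Y t) + tv_dist (law_at M X Y t) \<mu>) \<longlonglongrightarrow> 0"
      using tendsto_add[OF * lim] by simp
    then show "(\<lambda>t. tv_dist (law_at M X' Y t) \<mu>) \<longlonglongrightarrow> 0"
    proof (rule tendsto_sandwich[OF _ _ tendsto_const, rotated 2])
      show "\<forall>\<^sub>F t in sequentially. 0 \<le> tv_dist (law_at M X' Y t) \<mu>"
        by (intro always_eventually allI tv_dist_nonneg[OF law[OF X'(1)] \<mu>])
      show "\<forall>\<^sub>F t in sequentially. tv_dist (law_at M X' Y t) \<mu>
          \<le> tv_dist (law_at M X Y t) (law_at M X' Y t) + tv_dist (law_at M X Y t) \<mu>"
        unfolding tv_dist_commute[OF law[OF X_chain] law[OF X'(1)]]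
        by (intro always_eventually allI tv_dist_triangle[OF law[OF X'(1)] law[OF X_chain] \<mu>])
    qed
  qed
  have inv: "\<mu> \<bind> ?K = \<mu>"
  proof (rule tv_dist_le_0_imp_eq[OF bind_in_prob_algebra[OF \<mu> K] \<mu>])
    \<comment> \<open>The law at time \<open>t\<close> pushed through the kernel is the law at time
      \<open>Suc t\<close>, so both distances in the bound tend to 0.\<close>
    have "tv_dist (\<mu> \<bind> ?K) \<mu> \<le> tv_dist (law_at M X Y t) \<mu> + tv_dist (law_at M X Y (Suc t)) \<mu>" for t
    proof -
      have "tv_dist (\<mu> \<bind> ?K) \<mu> \<le> tv_dist (\<mu> \<bind> ?K) (law_at M X Y t \<bind> ?K) + tv_dist (law_at M X Y t \<bind> ?K) \<mu>"
        by (rule tv_dist_triangle[OF bind_in_prob_algebra[OF \<mu> K] bind_in_prob_algebra[OF law[OF X_chain] K] \<mu>])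
      also have "tv_dist (\<mu> \<bind> ?K) (law_at M X Y t \<bind> ?K) \<le> tv_dist (law_at M X Y t) \<mu>"
        unfolding tv_dist_commute[OF law[OF X_chain] \<mu>]
        by (rule tv_dist_bind_le[OF \<mu> law[OF X_chain] K space_stateM])
      finally show ?thesis by (simp add: law_at_Suc[OF M Q X_chain])
    qed
    moreover have "(\<lambda>t. tv_dist (law_at M X Y t) \<mu> + tv_dist (law_at M X Y (Suc t)) \<mu>) \<longlonglongrightarrow> 0"
      using tendsto_add[OF lim LIMSEQ_Suc[OF lim]] by simp
    ultimately show "tv_dist (\<mu> \<bind> ?K) \<mu> \<le> 0"
      by (intro LIMSEQ_le_const) auto
  qed
  have stationary: "law_at M X'' Y t = \<mu>" if "mcre M X'' Y Q" "law_at M X'' Y 0 = \<mu>" for X'' t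
    by (induction t) (simp_all add: that(2) law_at_Suc[OF M Q that(1)] inv)
  from \<mu> have "prob_space \<mu>" "sets \<mu> = sets ?S" by (simp_all add: space_prob_algebra)
  with lim XX' X'\<mu> stationary show ?thesis by blast
qed

end
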